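(* Let $M$ be a non-negative integer $(n\times n)$-matrix which is in primitive Frobenius form. Assume that $M$ has no zero columns. Then for any non-negative vector $\vec v\neq\vec 0$ in $\mathbb{R}^n$ there exists a normalization function $h_{\vec v}:\mathbb{N}\to\mathbb{R}$ such that $$\lim_{t\to\infty}\frac{M^t\vec v}{h_{\vec v}(t)}=\vec v_\infty,$$ where $\vec v_\infty\neq\vec 0$ is an eigenvector of $M$.
   Context: $M$ is in primitive Frobenius form if it is partitioned into matrix blocks such that $M$ is a lower triangular block matrix whose diagonal blocks are square, and every diagonal block is primitive (i.e. some power of it has only positive entries), where a $(1\times1)$ diagonal block with entry $1$ or $0$ is also allowed. A function $h:\mathbb{N}\to\mathbb{R}$ is a normalization function for a family $(\vec u_t)_{t\in\mathbb{N}}$ of vectors in $\mathbb{R}^n$ if $\lim_{t\to\infty}\vec u_t/h(t)$ exists and is different from $\vec 0$; here $h_{\vec v}$ is a normalization function for the family $(M^t\vec v)_{t\in\mathbb{N}}$. *)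

theory Defs
  imports
    Complex_Main
    "Jordan_Normal_Form.Char_Poly"
    "Jordan_Normal_Form.DL_Submatrix"
begin

text \<open>The exponent is required to be positive: otherwise the zero matrix of size one would be
  primitive, its zeroth power being the identity.\<close>

definition primitive_mat :: "'a :: linordered_idom mat \<Rightarrow> bool" where
  "primitive_mat A \<longleftrightarrow> square_mat A \<and>
     (\<exists>k>0. \<forall>i<dim_row A. \<forall>j<dim_row A. (A ^\<^sub>m k) $$ (i, j) > 0)"

text \<open>A partition of the row (and column) indices into consecutive blocks is given by the list
  \<open>ns\<close> of block sizes. Rows and columns carry the same partition, which is what it means for the
  diagonal blocks to be square.\<close>

definition block_indices :: "nat list \<Rightarrow> nat \<Rightarrow> nat set" where
  "block_indices ns p = {sum_list (take p ns) ..< sum_list (take (Suc p) ns)}"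

definition mat_block :: "nat list \<Rightarrow> 'a mat \<Rightarrow> nat \<Rightarrow> nat \<Rightarrow> 'a mat" where
  "mat_block ns A p q = submatrix A (block_indices ns p) (block_indices ns q)"

definition primitive_Frobenius_form :: "'a :: linordered_idom mat \<Rightarrow> bool" where
  "primitive_Frobenius_form A \<longleftrightarrow> square_mat A \<and>
     (\<exists>ns. (\<forall>s \<in> set ns. s > 0) \<and> sum_list ns = dim_row A \<and>
        (\<forall>p q. p < q \<and> q < length ns \<longrightarrow> mat_block ns A p q = 0\<^sub>m (ns ! p) (ns ! q)) \<and>
        (\<forall>p < length ns. primitive_mat (mat_block ns A p p) \<or>
           (ns ! p = 1 \<and> mat_block ns A p p $$ (0, 0) \<in> {0, 1})))"

text \<open>Convergence in \<open>\<real>\<^sup>n\<close>, componentwise because the type of vectors of varying dimension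
  carries no topology.\<close>

definition vec_tendsto :: "nat \<Rightarrow> (nat \<Rightarrow> real vec) \<Rightarrow> real vec \<Rightarrow> bool" where
  "vec_tendsto n u w \<longleftrightarrow> (\<forall>t. u t \<in> carrier_vec n) \<and> w \<in> carrier_vec n \<and>
     (\<forall>i<n. (\<lambda>t. u t $ i) \<longlonglongrightarrow> w $ i)"

text \<open>Since \<open>1 / 0 = 0\<close>, the requirement that the limit is nonzero forces \<open>h t \<noteq> 0\<close> for all but
  finitely many \<open>t\<close>, so that the convention for division by zero does not affect the limit.\<close>

definition normalization_function ::
    "nat \<Rightarrow> (nat \<Rightarrow> real vec) \<Rightarrow> (nat \<Rightarrow> real) \<Rightarrow> bool" where
  "normalization_function n u h \<longleftrightarrow>
     (\<exists>w. vec_tendsto n (\<lambda>t. (1 / h t) \<cdot>\<^sub>v u t) w \<and> w \<noteq> 0\<^sub>v n)"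

end

theory Submission
  imports "HOL-Analysis.Function_Topology" "HOL-Analysis.Uniform_Limit" Defs
begin

text \<open>
  Every coordinate of \<open>M\<^sup>t v\<close> turns out to have an exact order of growth: it vanishes
  eventually, or it is asymptotic to a positive multiple of some \<open>r\<^sup>t t\<^sup>k\<close> with \<open>r > 0\<close>. Such
  orders are linearly ordered by comparing \<open>(r, k)\<close> lexicographically. Dividing by the largest
  order that occurs among the coordinates therefore makes all of them converge, to a limit that is
  non-negative and nonzero. No order at all would occur only if \<open>M\<^sup>t v\<close> became zero, and the
  absence of zero columns prevents this, since a non-negative nonzero vector then has a nonzero
  image. The limit is an eigenvector because
  \<open>M (M\<^sup>t v) / h t = (M\<^sup>t\<^sup>+\<^sup>1 v / h (t + 1)) (h (t + 1) / h t)\<close> and \<open>h (t + 1) / h t\<close> tends to \<open>r\<close>.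

  The orders of growth are found block by block, from top to bottom
  (\<open>Frobenius_regular_growth\<close>). The part \<open>x\<close> of the vector in one diagonal block \<open>B\<close> satisfies
  \<open>x (t + 1) = B x t + b t\<close>, where the input \<open>b\<close> comes from the blocks above and so has regular
  growth already. Unrolling the recursion expresses \<open>x\<close> through convolutions of the entries of the
  powers of \<open>B\<close> with the input (\<open>variation_of_constants\<close>). For primitive \<open>B\<close>, the theorem of
  Perron and Frobenius makes every entry of \<open>B\<^sup>t\<close> asymptotic to a positive multiple of \<open>\<lambda>\<^sup>t\<close>
  for one common \<open>\<lambda> > 0\<close> (\<open>primitive_power_asymptotics\<close>), and convolution with such a sequence
  preserves regular growth (\<open>regular_growth_convolution\<close>). A zero block of size one only delays its
  input by one step.
\<close>

section \<open>Orders of growth\<close>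

text \<open>The order of growth \<open>r\<^sup>t t\<^sup>k\<close>, up to the constant factor \<open>k!\<close>. The binomial
  coefficient in place of \<open>t\<^sup>k\<close> is nonzero also at \<open>t = 0\<close>, and its partial sums are again
  binomial coefficients of this form, which makes resonant convolutions exact.\<close>

definition growth_scale :: "real \<Rightarrow> nat \<Rightarrow> nat \<Rightarrow> real" where
  "growth_scale r k t = r ^ t * real ((t + k) choose k)"

lemma growth_scale_pos: "r > 0 \<Longrightarrow> growth_scale r k t > 0"
  by (simp add: growth_scale_def)

lemma growth_scale_Suc: "growth_scale r k (Suc t) = growth_scale r k t * (r * (1 + real k / real (Suc t)))"
proof -
  have "Suc t * (Suc (t + k) choose k) = Suc (t + k) * ((t + k) choose k)"
    using Suc_times_binomial_add[of t k] binomial_symmetric[of k "Suc (t + k)"]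
      binomial_symmetric[of k "t + k"] Suc_times_binomial_eq[of "t + k" t]
    by (simp add: mult.commute)
  then have "real (Suc t) * real (Suc (t + k) choose k) = real (Suc (t + k)) * real ((t + k) choose k)"
    by (metis of_nat_mult)
  then have "real (Suc (t + k) choose k) = real ((t + k) choose k) * (1 + real k / real (Suc t))"
    by (simp add: field_simps)
  then show ?thesis
    by (simp add: growth_scale_def algebra_simps)
qed

lemma growth_scale_ratio_tendsto:
  assumes "r > 0"
  shows "(\<lambda>t. growth_scale r k (Suc t) / growth_scale r k t) \<longlonglongrightarrow> r"
proof -
  have "(\<lambda>t. r * (1 + real k / real (Suc t))) \<longlonglongrightarrow> r * (1 + 0)"
    by (intro tendsto_intros LIMSEQ_Suc[OF lim_const_over_n])
  moreover have "growth_scale r k (Suc t) / growth_scale r k t = r * (1 + real k / real (Suc t))" for t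
    using growth_scale_pos[OF assms, of k t] by (simp add: growth_scale_Suc)
  ultimately show ?thesis by simp
qed

lemma summable_growth_scale_div_power:
  assumes "0 < r" "r < s"
  shows "summable (\<lambda>t. growth_scale r k t / s ^ t)"
proof -
  define f where "f t = growth_scale r k t / s ^ t" for t
  have pos: "f t > 0" for t using growth_scale_pos[of r k t] assms by (simp add: f_def)
  have "(\<lambda>t. growth_scale r k (Suc t) / growth_scale r k t / s) \<longlonglongrightarrow> r / s"
    by (intro tendsto_intros growth_scale_ratio_tendsto) (use assms in auto)
  moreover have "growth_scale r k (Suc t) / growth_scale r k t / s = f (Suc t) / f t" for t
    using growth_scale_pos[of r k t] assms by (simp add: f_def field_simps)
  ultimately have lim: "(\<lambda>t. f (Suc t) / f t) \<longlonglongrightarrow> r / s" by simp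
  obtain c where c: "r / s < c" "c < 1" using assms dense[of "r/s" 1] by auto
  have "eventually (\<lambda>t. f (Suc t) / f t < c) sequentially"
    using order_tendstoD(2)[OF lim c(1)] .
  then obtain N where "\<And>t. t \<ge> N \<Longrightarrow> f (Suc t) / f t < c"
    by (auto simp: eventually_sequentially)
  then have "summable f"
    using pos by (intro summable_ratio_test[OF c(2), of N])
      (auto simp: field_simps less_imp_le abs_of_pos)
  then show ?thesis by (simp add: f_def[abs_def])
qed

text \<open>An exponential gap wins because \<open>growth_scale r k t / s\<^sup>t\<close> is the term of a convergent
  series. For equal rates one step of the exponent from \<open>k\<close> to \<open>k + 1\<close> already gains the
  factor \<open>(t + k + 1) / (k + 1)\<close>.\<close>

lemma growth_scale_strict_dominates:
  assumes "0 < r" "r < s \<or> r = s \<and> k < l"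
  shows "(\<lambda>t. growth_scale r k t / growth_scale s l t) \<longlonglongrightarrow> 0"
proof -
  have s: "s > 0" using assms by auto
  from assms(2) consider "r < s" | "r = s" "k < l" by auto
  then obtain b where b: "b \<longlonglongrightarrow> 0" "\<And>t. growth_scale r k t / growth_scale s l t \<le> b t"
  proof cases
    case 1
    have "growth_scale r k t / growth_scale s l t \<le> growth_scale r k t / s ^ t" for t
    proof -
      have "s ^ t * 1 \<le> s ^ t * real ((t + l) choose l)"
        using s by (intro mult_left_mono) (auto simp: Suc_le_eq)
      then show ?thesis
        using growth_scale_pos[OF assms(1), of k t] s by (intro divide_left_mono) (auto simp: growth_scale_def)
    qed
    then show ?thesis
      using that summable_LIMSEQ_zero[OF summable_growth_scale_div_power[OF assms(1) 1]] by blast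
  next
    case 2
    have "growth_scale r k t / growth_scale s l t \<le> real (Suc k) / real (Suc (t + k))" for t
    proof -
      have "Suc k * (Suc (t + k) choose Suc k) = Suc (t + k) * ((t + k) choose k)"
        using Suc_times_binomial_eq[of "t + k" k] by (simp only: mult.commute)
      then have "real (Suc k) * real (Suc (t + k) choose Suc k) = real (Suc (t + k)) * real ((t + k) choose k)"
        by (metis of_nat_mult)
      then have "real ((t + k) choose k) / real ((t + Suc k) choose Suc k) = real (Suc k) / real (Suc (t + k))"
        by (simp add: field_simps del: binomial_Suc_Suc)
      moreover have "(t + Suc k) choose t \<le> (t + l) choose t"
        using 2 by (intro binomial_right_mono) auto
      then have "(t + Suc k) choose Suc k \<le> (t + l) choose l"
        using binomial_symmetric[of t "t + Suc k"] binomial_symmetric[of t "t + l"] by simp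
      then have "real ((t + k) choose k) / real ((t + l) choose l) \<le>
          real ((t + k) choose k) / real ((t + Suc k) choose Suc k)"
        by (intro divide_left_mono) (auto simp del: binomial_Suc_Suc)
      ultimately show ?thesis using s 2 by (simp add: growth_scale_def)
    qed
    moreover have "(\<lambda>t. real (Suc k) / real (Suc (t + k))) \<longlonglongrightarrow> 0"
      using LIMSEQ_ignore_initial_segment[OF LIMSEQ_Suc[OF lim_const_over_n[of "real (Suc k)"]], of k] by simp
    ultimately show ?thesis using that by blast
  qed
  show ?thesis
    by (rule tendsto_sandwich[OF _ _ tendsto_const b(1)])
      (use b(2) growth_scale_pos[OF assms(1)] growth_scale_pos[OF s] in \<open>auto intro!: always_eventually simp: less_imp_le\<close>)
qed

definition regular_growth :: "(nat \<Rightarrow> real) \<Rightarrow> bool" where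
  "regular_growth f \<longleftrightarrow> (\<forall>\<^sub>F t in sequentially. f t = 0) \<or>
     (\<exists>r>0. \<exists>k. \<exists>c>0. (\<lambda>t. f t / growth_scale r k t) \<longlonglongrightarrow> c)"

lemma regular_growthI:
  "r > 0 \<Longrightarrow> c > 0 \<Longrightarrow> (\<lambda>t. f t / growth_scale r k t) \<longlonglongrightarrow> c \<Longrightarrow> regular_growth f"
  unfolding regular_growth_def by blast

lemma regular_growth_zero [simp]: "regular_growth (\<lambda>t. 0)"
  by (simp add: regular_growth_def)

lemma tendsto_div_larger_scale:
  assumes "(\<lambda>t. f t / growth_scale r k t) \<longlonglongrightarrow> c" "0 < r" "r < s \<or> r = s \<and> k < l"
  shows "(\<lambda>t. f t / growth_scale s l t) \<longlonglongrightarrow> 0"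
proof -
  have nz: "growth_scale r k t \<noteq> 0" for t using growth_scale_pos[OF assms(2), of k t] by simp
  have eq: "f t / growth_scale r k t * (growth_scale r k t / growth_scale s l t) = f t / growth_scale s l t" for t
    using nz by simp
  have "(\<lambda>t. f t / growth_scale r k t * (growth_scale r k t / growth_scale s l t)) \<longlonglongrightarrow> c * 0"
    by (intro tendsto_mult assms growth_scale_strict_dominates)
  then show ?thesis by (simp only: eq mult_zero_right)
qed

text \<open>A linear order of scales has a largest one among finitely many. Adding a function to the family
  either keeps the scale found so far or replaces it by a larger one, for which all the previous
  limits become zero.\<close>

lemma common_scale:
  assumes "finite I" "\<forall>i\<in>I. regular_growth (f i)"
  shows "(\<forall>i\<in>I. \<forall>\<^sub>F t in sequentially. f i t = 0) \<or>
    (\<exists>r>0. \<exists>k c. (\<forall>i\<in>I. 0 \<le> c i \<and> (\<lambda>t. f i t / growth_scale r k t) \<longlonglongrightarrow> c i) \<and> (\<exists>i\<in>I. c i > 0))"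
  using assms
proof (induction I rule: finite_induct)
  case (insert x I)
  have null: "(\<lambda>t. g t / growth_scale r k t) \<longlonglongrightarrow> 0" if "\<forall>\<^sub>F t in sequentially. g t = 0" for g r k
    using that by (intro tendsto_eventually) (auto elim: eventually_mono)
  have ex: "\<exists>r>0. \<exists>k c. (\<forall>i\<in>insert x I. 0 \<le> c i \<and> (\<lambda>t. f i t / growth_scale r k t) \<longlonglongrightarrow> c i) \<and> (\<exists>i\<in>insert x I. c i > 0)"
    if "0 < r" "(\<lambda>t. f x t / growth_scale r k t) \<longlonglongrightarrow> a" "0 \<le> a"
      "\<And>i. i \<in> I \<Longrightarrow> 0 \<le> c i \<and> (\<lambda>t. f i t / growth_scale r k t) \<longlonglongrightarrow> c i" "a > 0 \<or> (\<exists>i\<in>I. c i > 0)"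
    for r k a c
    using that insert.hyps by (intro exI[of _ r] conjI exI[of _ k] exI[of _ "c(x := a)"]) auto
  have "regular_growth (f x)" using insert.prems by blast
  moreover have "\<forall>i\<in>I. regular_growth (f i)" using insert.prems by blast
  note insert.IH[OF this]
  ultimately consider
      (zz) "\<forall>\<^sub>F t in sequentially. f x t = 0" "\<forall>i\<in>I. \<forall>\<^sub>F t in sequentially. f i t = 0"
    | (zp) r k c where "\<forall>\<^sub>F t in sequentially. f x t = 0" "r > 0"
        "\<forall>i\<in>I. 0 \<le> c i \<and> (\<lambda>t. f i t / growth_scale r k t) \<longlonglongrightarrow> c i" "\<exists>i\<in>I. c i > 0"
    | (pz) r k a where "r > 0" "a > 0" "(\<lambda>t. f x t / growth_scale r k t) \<longlonglongrightarrow> a"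
        "\<forall>i\<in>I. \<forall>\<^sub>F t in sequentially. f i t = 0"
    | (pp) r k a s l c where "r > 0" "a > 0" "(\<lambda>t. f x t / growth_scale r k t) \<longlonglongrightarrow> a" "s > 0"
        "\<forall>i\<in>I. 0 \<le> c i \<and> (\<lambda>t. f i t / growth_scale s l t) \<longlonglongrightarrow> c i" "\<exists>i\<in>I. c i > 0"
    unfolding regular_growth_def by (elim disjE exE conjE) blast+
  then show ?case
  proof cases
    case zz
    then show ?thesis by blast
  next
    case zp
    then show ?thesis by (intro disjI2[OF ex[of r k 0 c]]) (auto intro: null)
  next
    case pz
    then show ?thesis by (intro disjI2[OF ex[of r k a "\<lambda>_. 0"]]) (auto intro: null)
  next
    case pp
    consider "r = s" "k = l" | "r < s \<or> r = s \<and> k < l" | "s < r \<or> s = r \<and> l < k" by linarith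
    then show ?thesis
    proof cases
      case 1
      then show ?thesis using pp by (intro disjI2[OF ex[of r k a c]]) auto
    next
      case 2
      then show ?thesis using pp
        by (intro disjI2[OF ex[of s l 0 c]]) (auto intro: tendsto_div_larger_scale[OF pp(3)])
    next
      case 3
      then show ?thesis using pp
        by (intro disjI2[OF ex[of r k a "\<lambda>_. 0"]]) (auto intro: tendsto_div_larger_scale)
    qed
  qed
qed auto

text \<open>The leading constants are positive, so the dominant terms of a sum cannot cancel.\<close>

lemma regular_growth_sum:
  assumes "finite I" "\<And>i. i \<in> I \<Longrightarrow> regular_growth (f i)"
  shows "regular_growth (\<lambda>t. \<Sum>i\<in>I. f i t)"
proof -
  have "\<forall>i\<in>I. regular_growth (f i)" using assms(2) by blast
  from common_scale[OF assms(1) this] show ?thesis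
  proof (elim disjE exE conjE)
    assume "\<forall>i\<in>I. \<forall>\<^sub>F t in sequentially. f i t = 0"
    then have "\<forall>\<^sub>F t in sequentially. \<forall>i\<in>I. f i t = 0"
      using assms(1) by (simp add: eventually_ball_finite)
    then have "\<forall>\<^sub>F t in sequentially. (\<Sum>i\<in>I. f i t) = 0"
      by (rule eventually_mono) simp
    then show ?thesis by (simp add: regular_growth_def)
  next
    fix r k c assume *: "r > 0" "\<forall>i\<in>I. 0 \<le> c i \<and> (\<lambda>t. f i t / growth_scale r k t) \<longlonglongrightarrow> c i" "\<exists>i\<in>I. c i > 0"
    have "(\<lambda>t. \<Sum>i\<in>I. f i t / growth_scale r k t) \<longlonglongrightarrow> (\<Sum>i\<in>I. c i)"
      using * by (intro tendsto_sum) auto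
    moreover have "(\<Sum>i\<in>I. c i) > 0" using * assms(1) by (meson sum_pos2)
    ultimately show ?thesis
      using * by (intro regular_growthI[of r "\<Sum>i\<in>I. c i" _ k]) (auto simp: sum_divide_distrib)
  qed
qed

lemma regular_growth_cmult:
  assumes "a \<ge> 0" "regular_growth f"
  shows "regular_growth (\<lambda>t. a * f t)"
proof (cases "a = 0")
  case False
  with assms have a: "a > 0" by simp
  from assms(2) show ?thesis unfolding regular_growth_def
  proof (elim disjE exE conjE)
    assume "\<forall>\<^sub>F t in sequentially. f t = 0"
    then show "(\<forall>\<^sub>F t in sequentially. a * f t = 0) \<or>
        (\<exists>r>0. \<exists>k. \<exists>c>0. (\<lambda>t. a * f t / growth_scale r k t) \<longlonglongrightarrow> c)"
      by (intro disjI1) (auto elim: eventually_mono)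
  next
    fix r k c assume *: "r > 0" "c > 0" "(\<lambda>t. f t / growth_scale r k t) \<longlonglongrightarrow> c"
    then have "(\<lambda>t. a * (f t / growth_scale r k t)) \<longlonglongrightarrow> a * c" by (intro tendsto_intros)
    moreover have "a * c > 0" using a * by simp
    ultimately show "(\<forall>\<^sub>F t in sequentially. a * f t = 0) \<or>
        (\<exists>r>0. \<exists>k. \<exists>c>0. (\<lambda>t. a * f t / growth_scale r k t) \<longlonglongrightarrow> c)"
      using * by auto
  qed
qed simp

text \<open>A shift in time changes the leading constant by the factor \<open>1 / r\<close> only. This is used for
  inputs that act with a delay of one step.\<close>

lemma regular_growth_of_Suc:
  assumes "regular_growth (\<lambda>t. f (Suc t))"
  shows "regular_growth f"
  using assms unfolding regular_growth_def
proof (elim disjE exE conjE)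
  assume "\<forall>\<^sub>F t in sequentially. f (Suc t) = 0"
  then show "(\<forall>\<^sub>F t in sequentially. f t = 0) \<or>
        (\<exists>r>0. \<exists>k. \<exists>c>0. (\<lambda>t. f t / growth_scale r k t) \<longlonglongrightarrow> c)"
    using eventually_sequentially_Suc[of "\<lambda>t. f t = 0"] by blast
next
  fix r k c assume *: "r > 0" "c > 0" "(\<lambda>t. f (Suc t) / growth_scale r k t) \<longlonglongrightarrow> c"
  have "(\<lambda>t. f (Suc t) / growth_scale r k t / (growth_scale r k (Suc t) / growth_scale r k t)) \<longlonglongrightarrow> c / r"
    using * by (intro tendsto_divide growth_scale_ratio_tendsto) auto
  moreover have "f (Suc t) / growth_scale r k t / (growth_scale r k (Suc t) / growth_scale r k t) =
      f (Suc t) / growth_scale r k (Suc t)" for t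
    using growth_scale_pos[OF *(1), of k t] by simp
  ultimately have "(\<lambda>t. f (Suc t) / growth_scale r k (Suc t)) \<longlonglongrightarrow> c / r" by (simp only:)
  then have "(\<lambda>t. f t / growth_scale r k t) \<longlonglongrightarrow> c / r" by (rule LIMSEQ_imp_Suc)
  then show "(\<forall>\<^sub>F t in sequentially. f t = 0) \<or>
        (\<exists>r>0. \<exists>k. \<exists>c>0. (\<lambda>t. f t / growth_scale r k t) \<longlonglongrightarrow> c)"
    using * divide_pos_pos by blast
qed

section \<open>Convolutions\<close>

text \<open>Since \<open>\<gamma>\<close> is summable, only the terms with small \<open>j\<close> contribute, and for these
  \<open>a (t - j) / \<rho> t\<close> tends to \<open>L\<close>, as \<open>\<rho>\<close> grows subexponentially. Tannery's theorem
  justifies the exchange of limit and sum: monotonicity of \<open>\<rho>\<close> bounds the terms uniformly in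
  \<open>t\<close> by a multiple of \<open>\<gamma> j\<close>.\<close>

lemma dominated_convolution:
  fixes \<gamma> a \<rho> :: "nat \<Rightarrow> real"
  assumes "summable \<gamma>" "\<And>j. \<gamma> j \<ge> 0" "(\<lambda>t. a t / \<rho> t) \<longlonglongrightarrow> L" "\<And>t. \<rho> t > 0" "incseq \<rho>"
    "(\<lambda>t. \<rho> (Suc t) / \<rho> t) \<longlonglongrightarrow> 1"
  shows "(\<lambda>t. (\<Sum>j\<le>t. \<gamma> j * a (t - j)) / \<rho> t) \<longlonglongrightarrow> L * suminf \<gamma>"
proof -
  have \<rho>0: "\<rho> t \<noteq> 0" for t using assms(4)[of t] by simp
  obtain D where D: "\<And>t. \<bar>a t / \<rho> t\<bar> \<le> D"
    using convergent_imp_Bseq[OF convergentI[OF assms(3)]] by (auto simp: Bseq_def)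
  have shift: "(\<lambda>t. \<rho> t / \<rho> (t + j)) \<longlonglongrightarrow> 1" for j
  proof (induction j)
    case (Suc j)
    have "(\<lambda>t. \<rho> (Suc (t + j)) / \<rho> (t + j)) \<longlonglongrightarrow> 1"
      using LIMSEQ_ignore_initial_segment[OF assms(6), of j] by simp
    then have "(\<lambda>t. \<rho> t / \<rho> (t + j) / (\<rho> (Suc (t + j)) / \<rho> (t + j))) \<longlonglongrightarrow> 1 / 1"
      by (intro tendsto_divide Suc.IH) auto
    then show ?case using \<rho>0 by simp
  qed (use \<rho>0 in simp)
  define b where "b j t = (if j \<le> t then \<gamma> j * a (t - j) / \<rho> t else 0)" for j t
  have lim: "(\<lambda>t. b j t) \<longlonglongrightarrow> \<gamma> j * L" for j
  proof (rule LIMSEQ_offset[where k = j])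
    have "(\<lambda>t. \<gamma> j * (a t / \<rho> t * (\<rho> t / \<rho> (t + j)))) \<longlonglongrightarrow> \<gamma> j * (L * 1)"
      by (intro tendsto_intros assms(3) shift)
    then show "(\<lambda>t. b j (t + j)) \<longlonglongrightarrow> \<gamma> j * L"
      using \<rho>0 by (simp add: b_def)
  qed
  have bound: "norm (b j t) \<le> D * \<gamma> j" for j t
  proof (cases "j \<le> t")
    case True
    have "\<bar>a (t - j)\<bar> \<le> D * \<rho> (t - j)"
      using D[of "t - j"] assms(4)[of "t - j"] by (simp add: field_simps)
    also have "\<dots> \<le> D * \<rho> t"
      using order.trans[OF abs_ge_zero D[of 0]] assms(5)
      by (intro mult_left_mono) (simp_all add: incseq_def)
    finally have "\<bar>a (t - j)\<bar> / \<rho> t \<le> D" using assms(4)[of t] by (simp add: field_simps)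
    then have "\<gamma> j * (\<bar>a (t - j)\<bar> / \<rho> t) \<le> \<gamma> j * D" using assms(2) by (rule mult_left_mono)
    then show ?thesis using True assms(2)[of j] assms(4)[of t] by (simp add: b_def abs_mult mult.commute)
  next
    case False
    then show ?thesis using order.trans[OF abs_ge_zero D[of 0]] assms(2)[of j] by (simp add: b_def)
  qed
  have ev: "\<forall>\<^sub>F (j, t) in sequentially \<times>\<^sub>F sequentially. norm (b j t) \<le> D * \<gamma> j"
    using bound by (intro always_eventually) auto
  have "(\<lambda>t. suminf (\<lambda>j. b j t)) \<longlonglongrightarrow> suminf (\<lambda>j. \<gamma> j * L)"
    using tannerys_theorem[OF lim ev summable_mult[OF assms(1)]] by simp
  moreover have "suminf (\<lambda>j. b j t) = (\<Sum>j\<le>t. \<gamma> j * a (t - j)) / \<rho> t" for t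
  proof -
    have "suminf (\<lambda>j. b j t) = (\<Sum>j\<le>t. b j t)" by (rule suminf_finite) (auto simp: b_def)
    then show ?thesis by (simp add: b_def sum_divide_distrib)
  qed
  moreover have "suminf (\<lambda>j. \<gamma> j * L) = L * suminf \<gamma>"
    using suminf_mult2[OF assms(1), of L] by (simp add: mult.commute)
  ultimately show ?thesis by simp
qed

text \<open>The theorem of Silverman and Toeplitz: the weights of any fixed initial segment die out, so that
  the weighted sum sees only values of \<open>a\<close> that are close to \<open>L\<close>.\<close>

lemma Toeplitz_limit:
  fixes w :: "nat \<Rightarrow> nat \<Rightarrow> real" and a :: "nat \<Rightarrow> real"
  assumes "\<And>t s. s \<le> t \<Longrightarrow> w t s \<ge> 0" "(\<lambda>t. \<Sum>s\<le>t. w t s) \<longlonglongrightarrow> W" "\<And>s. (\<lambda>t. w t s) \<longlonglongrightarrow> 0" "a \<longlonglongrightarrow> L"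
  shows "(\<lambda>t. \<Sum>s\<le>t. w t s * a s) \<longlonglongrightarrow> W * L"
proof -
  have "(\<lambda>t. \<Sum>s\<le>t. w t s * (a s - L)) \<longlonglongrightarrow> 0"
  proof (rule LIMSEQ_I)
    fix e :: real assume e: "e > 0"
    obtain C where C: "C > 0" "\<And>t. \<bar>\<Sum>s\<le>t. w t s\<bar> \<le> C"
      using convergent_imp_Bseq[OF convergentI[OF assms(2)]] by (auto simp: Bseq_def)
    define d where "d = e / (2 * C)"
    have d: "d > 0" using e C by (simp add: d_def)
    obtain N where N: "\<And>s. s \<ge> N \<Longrightarrow> \<bar>a s - L\<bar> < d"
      using LIMSEQ_D[OF assms(4) d] by auto
    have "(\<lambda>t. \<Sum>s<N. w t s * (a s - L)) \<longlonglongrightarrow> (\<Sum>s<N. 0 * (a s - L))"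
      by (intro tendsto_sum tendsto_mult assms(3) tendsto_const)
    then obtain K where K: "\<And>t. t \<ge> K \<Longrightarrow> \<bar>\<Sum>s<N. w t s * (a s - L)\<bar> < e / 2"
      using LIMSEQ_D[of _ 0 "e / 2"] e by fastforce
    show "\<exists>no. \<forall>t\<ge>no. norm ((\<Sum>s\<le>t. w t s * (a s - L)) - 0) < e"
    proof (intro exI[of _ "max K N"] allI impI)
      fix t assume t: "t \<ge> max K N"
      have "\<bar>\<Sum>s\<in>{N..t}. w t s * (a s - L)\<bar> \<le> (\<Sum>s\<in>{N..t}. w t s * d)"
        using N assms(1) by (intro order.trans[OF sum_abs] sum_mono)
          (auto simp: abs_mult less_imp_le intro!: mult_left_mono)
      also have "\<dots> \<le> (\<Sum>s\<le>t. w t s * d)"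
        using assms(1) d by (intro sum_mono2) auto
      also have "\<dots> = (\<Sum>s\<le>t. w t s) * d" by (simp add: sum_distrib_right)
      also have "\<dots> \<le> C * d" using C(2)[of t] d by (intro mult_right_mono) auto
      also have "\<dots> = e / 2" using C by (simp add: d_def)
      finally have "\<bar>\<Sum>s\<in>{N..t}. w t s * (a s - L)\<bar> \<le> e / 2" .
      moreover have "(\<Sum>s\<le>t. w t s * (a s - L)) = (\<Sum>s<N. w t s * (a s - L)) + (\<Sum>s\<in>{N..t}. w t s * (a s - L))"
        using t by (subst sum.union_disjoint[symmetric]) (auto intro: sum.cong)
      ultimately show "norm ((\<Sum>s\<le>t. w t s * (a s - L)) - 0) < e"
        using K[of t] t by auto
    qed
  qed
  moreover have "(\<lambda>t. (\<Sum>s\<le>t. w t s) * L) \<longlonglongrightarrow> W * L" by (intro tendsto_intros assms)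
  ultimately have "(\<lambda>t. (\<Sum>s\<le>t. w t s * (a s - L)) + (\<Sum>s\<le>t. w t s) * L) \<longlonglongrightarrow> 0 + W * L"
    by (rule tendsto_add)
  moreover have "(\<Sum>s\<le>t. w t s * (a s - L)) + (\<Sum>s\<le>t. w t s) * L = (\<Sum>s\<le>t. w t s * a s)" for t
    unfolding sum_distrib_right sum.distrib[symmetric] by (simp add: right_diff_distrib)
  ultimately show ?thesis by simp
qed

lemma incseq_growth_scale_one: "incseq (growth_scale 1 k)"
proof (rule incseq_SucI)
  fix t show "growth_scale 1 k t \<le> growth_scale 1 k (Suc t)"
    using growth_scale_pos[of 1 k t] by (simp add: growth_scale_Suc field_simps)
qed

lemma sum_growth_scale_one: "(\<Sum>s\<le>t. growth_scale 1 k s) = growth_scale 1 (Suc k) t"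
proof -
  have "(\<Sum>s\<le>t. (s + k) choose k) = (t + Suc k) choose Suc k"
    using choose_rising_sum(1)[of k t] by (simp add: add.commute)
  then show ?thesis by (simp add: growth_scale_def flip: of_nat_sum)
qed

text \<open>When both factors of a convolution have the same exponential rate, no term dominates, and the
  exponent of the polynomial factor rises by one. The limit comes from two applications of the
  theorem of Silverman and Toeplitz: first the weights \<open>growth_scale 1 k s / growth_scale 1 (Suc k) t\<close>,
  whose sum over \<open>s \<le> t\<close> is exactly one, average the ratio \<open>q s / growth_scale 1 k s\<close>; then the
  weights \<open>q (t - j) / growth_scale 1 (Suc k) t\<close>, whose sums therefore tend to \<open>d\<close>, average
  \<open>p\<close>.\<close>

lemma resonant_convolution:
  fixes p q :: "nat \<Rightarrow> real"
  assumes "p \<longlonglongrightarrow> c" "(\<lambda>t. q t / growth_scale 1 k t) \<longlonglongrightarrow> d" "\<And>t. q t \<ge> 0"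
  shows "(\<lambda>t. (\<Sum>j\<le>t. p j * q (t - j)) / growth_scale 1 (Suc k) t) \<longlonglongrightarrow> c * d"
proof -
  let ?R = "growth_scale 1 k" and ?R' = "growth_scale 1 (Suc k)"
  have pos: "?R t > 0" "?R' t > 0" for t by (auto intro: growth_scale_pos)
  have nz: "?R t \<noteq> 0" "?R' t \<noteq> 0" for t using pos[of t] by auto
  have dom: "(\<lambda>t. ?R t / ?R' t) \<longlonglongrightarrow> 0" by (intro growth_scale_strict_dominates) auto
  have inf: "(\<lambda>t. 1 / ?R' t) \<longlonglongrightarrow> 0"
    using growth_scale_strict_dominates[of 1 1 0 "Suc k"] by (simp add: growth_scale_def)
  have "(\<lambda>t. \<Sum>s\<le>t. ?R s / ?R' t * (q s / ?R s)) \<longlonglongrightarrow> 1 * d"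
  proof (rule Toeplitz_limit)
    show "(\<lambda>t. \<Sum>s\<le>t. ?R s / ?R' t) \<longlonglongrightarrow> 1"
      using nz by (simp add: sum_growth_scale_one flip: sum_divide_distrib)
    show "(\<lambda>t. ?R s / ?R' t) \<longlonglongrightarrow> 0" for s
      using tendsto_mult_right_zero[OF inf, of "?R s"] by simp
  qed (use pos assms in \<open>auto simp: less_imp_le\<close>)
  then have Q: "(\<lambda>t. (\<Sum>s\<le>t. q s) / ?R' t) \<longlonglongrightarrow> d"
    using nz by (simp add: sum_divide_distrib)
  have "(\<lambda>t. \<Sum>j\<le>t. q (t - j) / ?R' t * p j) \<longlonglongrightarrow> d * c"
  proof (rule Toeplitz_limit)
    have "(\<Sum>j\<le>t. q (t - j)) = (\<Sum>s\<le>t. q s)" for t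
      using sum.nat_diff_reindex[of q "Suc t"] by (simp add: lessThan_Suc_atMost)
    then show "(\<lambda>t. \<Sum>j\<le>t. q (t - j) / ?R' t) \<longlonglongrightarrow> d"
      using Q by (simp flip: sum_divide_distrib)
    obtain D where D: "\<And>t. \<bar>q t / ?R t\<bar> \<le> D"
      using convergent_imp_Bseq[OF convergentI[OF assms(2)]] by (auto simp: Bseq_def)
    show "(\<lambda>t. q (t - j) / ?R' t) \<longlonglongrightarrow> 0" for j
    proof (rule tendsto_sandwich[OF _ _ tendsto_const])
      show "(\<lambda>t. D * (?R t / ?R' t)) \<longlonglongrightarrow> 0" using tendsto_mult_right_zero[OF dom] .
      have "q (t - j) \<le> D * ?R t" for t
      proof -
        have "q (t - j) \<le> D * ?R (t - j)"
          using D[of "t - j"] pos[of "t - j"] by (simp add: field_simps)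
        also have "\<dots> \<le> D * ?R t"
          using incseq_growth_scale_one[of k] order.trans[OF abs_ge_zero D[of 0]]
          by (intro mult_left_mono) (simp_all add: incseq_def)
        finally show ?thesis .
      qed
      then show "\<forall>\<^sub>F t in sequentially. q (t - j) / ?R' t \<le> D * (?R t / ?R' t)"
        using pos by (intro always_eventually) (auto simp: divide_right_mono less_imp_le)
    qed (use assms(3) pos in \<open>auto intro!: always_eventually divide_nonneg_pos\<close>)
  qed (use assms pos in \<open>auto intro!: divide_nonneg_pos\<close>)
  then show ?thesis by (simp add: sum_divide_distrib mult.commute)
qed

text \<open>The result depends on which factor grows faster. If \<open>g\<close> has a rate below \<open>r\<close>, the sum is
  dominated by early values of \<open>g\<close> and inherits the order \<open>r\<^sup>t\<close> of \<open>f\<close>. If the rate of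
  \<open>g\<close> is larger, the early values of \<open>f\<close> dominate and the order of \<open>g\<close> is kept. Equal
  rates are the resonant case. Non-negativity keeps the leading constants positive.\<close>

lemma regular_growth_convolution:
  assumes r: "r > 0" and c: "c > 0" and f: "(\<lambda>t. f t / r ^ t) \<longlonglongrightarrow> c"
    and f_nonneg: "\<And>t. f t \<ge> 0" and g: "regular_growth g" and g_nonneg: "\<And>t. g t \<ge> 0"
  shows "regular_growth (\<lambda>t. \<Sum>j\<le>t. f j * g (t - j))"
proof -
  define p where "p t = f t / r ^ t" for t
  have p: "p \<longlonglongrightarrow> c" "\<And>t. p t \<ge> 0" using f f_nonneg r by (auto simp: p_def[abs_def])
  have f_eq: "f t = p t * r ^ t" for t using r by (simp add: p_def)
  let ?h = "\<lambda>t. \<Sum>j\<le>t. f j * g (t - j)"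
  \<comment> \<open>This covers both an eventually vanishing \<open>g\<close> and a \<open>g\<close> of exponential rate below \<open>r\<close>.\<close>
  have slow: ?thesis if sm: "summable (\<lambda>s. g s / r ^ s)"
  proof (cases "\<forall>s. g s = 0")
    case True
    then show ?thesis by simp
  next
    case False
    have "(\<lambda>t. (\<Sum>j\<le>t. g j / r ^ j * p (t - j)) / 1) \<longlonglongrightarrow> c * (\<Sum>s. g s / r ^ s)"
      using p sm g_nonneg r by (intro dominated_convolution[where \<rho> = "\<lambda>_. 1"]) auto
    moreover have "?h t / growth_scale r 0 t = (\<Sum>j\<le>t. g j / r ^ j * p (t - j))" for t
    proof -
      have "?h t = (\<Sum>j\<le>t. f (t - j) * g j)"
        using sum.nat_diff_reindex[of "\<lambda>j. f j * g (t - j)" "Suc t"]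
        by (simp add: lessThan_Suc_atMost)
      then show ?thesis using r
        by (auto simp: growth_scale_def sum_divide_distrib p_def power_diff intro!: sum.cong)
    qed
    moreover have "(\<Sum>s. g s / r ^ s) > 0"
    proof -
      obtain s where "g s \<noteq> 0" using False by blast
      then have "g s / r ^ s > 0" using g_nonneg[of s] r by simp
      then show ?thesis using sm g_nonneg r by (intro suminf_pos2[of _ s]) auto
    qed
    ultimately show ?thesis using r c by (intro regular_growthI[of r "c * (\<Sum>s. g s / r ^ s)" _ 0]) auto
  qed
  from g show ?thesis unfolding regular_growth_def[of g]
  proof (elim disjE exE conjE)
    assume "\<forall>\<^sub>F t in sequentially. g t = 0"
    then have "\<forall>\<^sub>F t in sequentially. g t / r ^ t = 0" by (rule eventually_mono) simp
    from summable_cong[OF this] show ?thesis by (intro slow) simp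
  next
    fix s k d assume s: "s > 0" and d: "d > 0" and g_lim: "(\<lambda>t. g t / growth_scale s k t) \<longlonglongrightarrow> d"
    define q where "q t = g t / s ^ t" for t
    have g_eq: "g t = q t * s ^ t" for t using s by (simp add: q_def)
    have q_lim: "(\<lambda>t. q t / growth_scale 1 k t) \<longlonglongrightarrow> d"
      using g_lim s by (simp add: q_def growth_scale_def divide_divide_eq_left)
    have q_nonneg: "q t \<ge> 0" for t using g_nonneg s by (simp add: q_def)
    consider "s < r" | "s = r" | "r < s" by linarith
    then show ?thesis
    proof cases
      case 1
      obtain D where D: "\<And>t. \<bar>g t / growth_scale s k t\<bar> \<le> D"
        using convergent_imp_Bseq[OF convergentI[OF g_lim]] by (auto simp: Bseq_def)
      have bound: "norm (g t / r ^ t) \<le> D * (growth_scale s k t / r ^ t)" for t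
      proof -
        have "g t \<le> D * growth_scale s k t"
          using D[of t] growth_scale_pos[OF s, of k t] by (simp add: pos_divide_le_eq)
        then have "g t / r ^ t \<le> D * growth_scale s k t / r ^ t"
          using r by (intro divide_right_mono) auto
        then show ?thesis using g_nonneg[of t] r by simp
      qed
      have "summable (\<lambda>t. D * (growth_scale s k t / r ^ t))"
        by (intro summable_mult summable_growth_scale_div_power s 1)
      then have "summable (\<lambda>t. g t / r ^ t)"
        by (rule summable_comparison_test'[where N = 0]) (rule bound)
      then show ?thesis by (rule slow)
    next
      case 2
      have "?h t / growth_scale r (Suc k) t = (\<Sum>j\<le>t. p j * q (t - j)) / growth_scale 1 (Suc k) t" for t
      proof -
        have "f j * g (t - j) = r ^ t * (p j * q (t - j))" if "j \<le> t" for j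
          using that r by (simp add: f_eq g_eq 2 power_diff)
        then have "?h t = r ^ t * (\<Sum>j\<le>t. p j * q (t - j))" by (simp add: sum_distrib_left)
        then show ?thesis using r by (simp add: growth_scale_def)
      qed
      moreover have "(\<lambda>t. (\<Sum>j\<le>t. p j * q (t - j)) / growth_scale 1 (Suc k) t) \<longlonglongrightarrow> c * d"
        by (intro resonant_convolution p q_lim q_nonneg)
      ultimately show ?thesis using c d r by (intro regular_growthI[of r "c * d" _ "Suc k"]) auto
    next
      case 3
      define \<gamma> where "\<gamma> j = p j * (r / s) ^ j" for j
      obtain D where D: "\<And>t. \<bar>p t\<bar> \<le> D"
        using convergent_imp_Bseq[OF convergentI[OF p(1)]] by (auto simp: Bseq_def)
      have bound: "norm (\<gamma> j) \<le> D * (r / s) ^ j" for j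
        using D[of j] r s mult_right_mono[OF D[of j], of "(r / s) ^ j"]
        by (simp add: \<gamma>_def abs_mult)
      have "summable (\<lambda>j. D * (r / s) ^ j)"
        using r s 3 by (intro summable_mult summable_geometric) simp
      then have "summable \<gamma>"
        by (rule summable_comparison_test'[where N = 0]) (rule bound)
      moreover have \<gamma>_nonneg: "\<gamma> j \<ge> 0" for j using p r s by (simp add: \<gamma>_def)
      ultimately have "(\<lambda>t. (\<Sum>j\<le>t. \<gamma> j * q (t - j)) / growth_scale 1 k t) \<longlonglongrightarrow> d * suminf \<gamma>"
        using q_lim growth_scale_ratio_tendsto[of 1 k]
        by (intro dominated_convolution incseq_growth_scale_one growth_scale_pos) auto
      moreover have "?h t / growth_scale s k t = (\<Sum>j\<le>t. \<gamma> j * q (t - j)) / growth_scale 1 k t" for t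
      proof -
        have "f j * g (t - j) = s ^ t * (\<gamma> j * q (t - j))" if "j \<le> t" for j
          using that s by (simp add: f_eq g_eq \<gamma>_def power_divide power_diff)
        then have "?h t = s ^ t * (\<Sum>j\<le>t. \<gamma> j * q (t - j))" by (simp add: sum_distrib_left)
        then show ?thesis using s by (simp add: growth_scale_def)
      qed
      moreover have "suminf \<gamma> > 0"
      proof -
        obtain j where "p j > 0" using order_tendstoD(1)[OF p(1) c] by (auto simp: eventually_sequentially)
        then have "\<gamma> j > 0" using r s by (simp add: \<gamma>_def)
        then show ?thesis using \<open>summable \<gamma>\<close> \<gamma>_nonneg by (intro suminf_pos2[of _ j]) auto
      qed
      ultimately show ?thesis using d s by (intro regular_growthI[of s "d * suminf \<gamma>" _ k]) auto
    qed
  qed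
qed

section \<open>Powers of primitive matrices\<close>

text \<open>The matrix-vector product on vectors represented as functions. Function spaces carry a topology,
  and restricting a vector to a block of indices becomes a mere shift of the argument.\<close>

definition mat_act :: "real mat \<Rightarrow> (nat \<Rightarrow> real) \<Rightarrow> nat \<Rightarrow> real" where
  "mat_act A x i = (\<Sum>j<dim_col A. A $$ (i, j) * x j)"

lemma mat_mult_index:
  assumes "A \<in> carrier_mat m m" "B \<in> carrier_mat m m" "i < m" "j < m"
  shows "(A * B) $$ (i, j) = (\<Sum>l<m. A $$ (i, l) * B $$ (l, j))"
  using assms by (simp add: scalar_prod_def lessThan_atLeast0)

lemma mat_act_mult:
  assumes "A \<in> carrier_mat m m" "B \<in> carrier_mat m m" "i < m"
  shows "mat_act (A * B) x i = mat_act A (mat_act B x) i"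
proof -
  have [simp]: "dim_col (A * B) = m" using assms by simp
  have "mat_act (A * B) x i = (\<Sum>j<m. \<Sum>l<m. A $$ (i, l) * (B $$ (l, j) * x j))"
    using assms by (auto simp: mat_act_def mat_mult_index[OF assms(1,2)] sum_distrib_right mult.assoc
        simp del: index_mult_mat intro!: sum.cong)
  also have "\<dots> = (\<Sum>l<m. \<Sum>j<m. A $$ (i, l) * (B $$ (l, j) * x j))" by (rule sum.swap)
  also have "\<dots> = mat_act A (mat_act B x) i"
    using assms by (simp add: mat_act_def sum_distrib_left)
  finally show ?thesis .
qed

lemma mat_act_cong:
  "(\<And>j. j < dim_col A \<Longrightarrow> x j = y j) \<Longrightarrow> mat_act A x i = mat_act A y i"
  by (simp add: mat_act_def)

lemma mat_act_diff: "mat_act A (\<lambda>j. x j - c * y j) i = mat_act A x i - c * mat_act A y i"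
  by (simp add: mat_act_def algebra_simps sum_subtractf sum_distrib_left)

lemma pow_mat_Suc_left:
  assumes "A \<in> carrier_mat m m"
  shows "A ^\<^sub>m Suc k = A * A ^\<^sub>m k"
proof (induction k)
  case (Suc k)
  then show ?case
    using assoc_mult_mat[OF assms pow_carrier_mat[OF assms, of k] assms] by simp
qed (use assms in simp)

lemma pow_mat_nonneg:
  assumes "A \<in> carrier_mat m m" "\<forall>i<m. \<forall>j<m. (0::real) \<le> A $$ (i, j)" "i < m" "j < m"
  shows "(A ^\<^sub>m k) $$ (i, j) \<ge> 0"
  using assms(3,4)
proof (induction k arbitrary: i j)
  case (Suc k)
  then show ?case
    using assms(1,2) by (simp only: pow_mat.simps mat_mult_index[OF pow_carrier_mat[OF assms(1)] assms(1) Suc.prems])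
      (auto intro!: sum_nonneg)
qed (use assms(1) in \<open>auto simp: one_mat_def\<close>)

text \<open>The pairs of a probability vector \<open>x\<close> and a number \<open>r \<le> R\<close> with \<open>r x \<le> A x\<close>, the
  domain of the Collatz-Wielandt maximization. Setting the coordinates from \<open>m\<close> on to zero makes
  the set a closed part of a product of compact intervals, to which Tychonoff's theorem applies.\<close>

lemma compact_simplex_extended:
  fixes R :: real
  shows "compact {(r, x :: nat \<Rightarrow> real). 0 \<le> r \<and> r \<le> R \<and> (\<forall>i. 0 \<le> x i) \<and> (\<forall>i\<ge>m. x i = 0) \<and> (\<Sum>i<m. x i) = 1
     \<and> (\<forall>i<m. r * x i \<le> mat_act A x i)}" (is "compact ?K")
proof -
  let ?B = "\<lambda>i. if i < m then {0..1::real} else {0}"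
  have "compactin (product_topology (\<lambda>i::nat. euclidean :: real topology) UNIV) (PiE UNIV ?B)"
    by (subst compactin_PiE) auto
  then have "compact (PiE UNIV ?B)" by (simp add: euclidean_product_topology)
  then have cpt: "compact ({0..R} \<times> PiE UNIV ?B)" by (intro compact_Times) auto
  have coord: "continuous_on UNIV (\<lambda>p :: real \<times> (nat \<Rightarrow> real). snd p i)" for i
    by (rule continuous_on_product_then_coordinatewise) (intro continuous_intros)
  have "closed {p :: real \<times> (nat \<Rightarrow> real). (\<Sum>i<m. snd p i) = 1}"
    by (intro closed_Collect_eq continuous_on_sum coord continuous_intros)
  moreover have "closed {p :: real \<times> (nat \<Rightarrow> real). \<forall>i. i < m \<longrightarrow> fst p * snd p i \<le> mat_act A (snd p) i}"
    unfolding mat_act_def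
    by (intro closed_Collect_all closed_Collect_imp open_Collect_const closed_Collect_le
        continuous_on_sum continuous_on_mult coord continuous_intros)
  ultimately have "compact (({0..R} \<times> PiE UNIV ?B) \<inter> ({p. (\<Sum>i<m. snd p i) = 1} \<inter>
      {p. \<forall>i. i < m \<longrightarrow> fst p * snd p i \<le> mat_act A (snd p) i}))"
    by (intro compact_Int_closed cpt closed_Int)
  also have "({0..R} \<times> PiE UNIV ?B) \<inter> ({p. (\<Sum>i<m. snd p i) = 1} \<inter>
      {p. \<forall>i. i < m \<longrightarrow> fst p * snd p i \<le> mat_act A (snd p) i}) = ?K"
  proof -
    have "x i \<le> 1" if "\<forall>i. 0 \<le> x i" "(\<Sum>i<m. x i) = 1" "i < m" for x :: "nat \<Rightarrow> real" and i
      using that member_le_sum[of i "{..<m}" x] by auto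
    then show ?thesis
      by (auto simp: PiE_def Pi_def split: if_splits) (metis order.refl)+
  qed
  finally show ?thesis .
qed

lemma mat_act_pow_eigenvector:
  assumes B: "B \<in> carrier_mat m m" and eig: "\<forall>i<m. mat_act B x i = r * x i" and "i < m"
  shows "mat_act (B ^\<^sub>m t) x i = r ^ t * x i"
  using assms(3)
proof (induction t arbitrary: i)
  case 0
  have "mat_act (B ^\<^sub>m 0) x i = (\<Sum>j<m. if j = i then x j else 0)"
    unfolding mat_act_def using B 0 by (intro sum.cong) auto
  then show ?case using 0 by simp
next
  case (Suc t)
  have "mat_act (B ^\<^sub>m Suc t) x i = mat_act (B ^\<^sub>m t) (mat_act B x) i"
    using mat_act_mult[OF pow_carrier_mat[OF B] B Suc.prems] by simp
  also have "\<dots> = mat_act (B ^\<^sub>m t) (\<lambda>j. r * x j) i"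
    using B eig by (intro mat_act_cong) (auto split: if_splits)
  also have "\<dots> = r * mat_act (B ^\<^sub>m t) x i"
    by (simp add: mat_act_def sum_distrib_left mult.left_commute)
  finally show ?case using Suc by simp
qed

text \<open>The argument of Collatz and Wielandt: choose the largest \<open>r\<close> such that \<open>r x \<le> B x\<close> for some
  probability vector \<open>x\<close>. If this inequality were strict in one coordinate, applying the positive
  matrix \<open>B\<^sup>k\<close> would make it strict in all of them, for the vector \<open>y = B\<^sup>k x\<close>, and \<open>r\<close>
  could be increased. Hence \<open>x\<close> is an eigenvector, and \<open>r\<^sup>k x = B\<^sup>k x > 0\<close> gives positivity
  of both \<open>r\<close> and \<open>x\<close>.\<close>

theorem Perron_eigenvector:
  assumes B: "B \<in> carrier_mat m m" and nonneg: "\<forall>i<m. \<forall>j<m. (0::real) \<le> B $$ (i, j)"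
    and k: "k > 0" and pos: "\<forall>i<m. \<forall>j<m. (B ^\<^sub>m k) $$ (i, j) > 0" and m: "m > 0"
  shows "\<exists>r>0. \<exists>x. \<forall>i<m. x i > 0 \<and> mat_act B x i = r * x i"
proof -
  note pw = pow_carrier_mat[OF B]
  \<comment> \<open>Summing \<open>r x \<le> B x\<close> over the coordinates of a probability vector shows \<open>r \<le> R\<close>.\<close>
  define R where "R = (\<Sum>i<m. \<Sum>j<m. B $$ (i, j))"
  define K where "K = {(r, x :: nat \<Rightarrow> real). 0 \<le> r \<and> r \<le> R \<and> (\<forall>i. 0 \<le> x i) \<and> (\<forall>i\<ge>m. x i = 0) \<and> (\<Sum>i<m. x i) = 1
     \<and> (\<forall>i<m. r * x i \<le> mat_act B x i)}"
  have "compact (fst ` K)"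
    unfolding K_def by (intro compact_continuous_image compact_simplex_extended continuous_intros)
  moreover have "R \<ge> 0" unfolding R_def using nonneg by (auto intro!: sum_nonneg)
  then have "(0, \<lambda>i. if i = 0 then 1 else 0) \<in> K"
    using m B nonneg by (auto simp: K_def mat_act_def sum.delta intro!: sum_nonneg)
  then have "fst ` K \<noteq> {}" by blast
  ultimately obtain r where r: "r \<in> fst ` K" "\<forall>s\<in>fst ` K. s \<le> r"
    using compact_attains_sup[of "fst ` K"] by metis
  then obtain x where x: "(r, x) \<in> K" by auto
  have x_nonneg: "x i \<ge> 0" for i using x by (simp add: K_def)
  have x_sum: "(\<Sum>i<m. x i) = 1" using x by (simp add: K_def)
  have sub: "r * x i \<le> mat_act B x i" if "i < m" for i using x that by (simp add: K_def)
  have act_pos: "mat_act (B ^\<^sub>m k) d i > 0" if "\<And>j. j < m \<Longrightarrow> d j \<ge> 0" "j < m" "d j > 0" "i < m" for d i j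
  proof -
    have "0 \<le> (B ^\<^sub>m k) $$ (i, l) * d l" if "l < m" for l
      using pos \<open>i < m\<close> that \<open>\<And>j. j < m \<Longrightarrow> d j \<ge> 0\<close> by (simp add: less_imp_le)
    moreover have "0 < (B ^\<^sub>m k) $$ (i, j) * d j" using pos that by simp
    ultimately show ?thesis
      unfolding mat_act_def carrier_matD(2)[OF pw] using \<open>j < m\<close> by (intro sum_pos2[of _ j]) auto
  qed
  have "\<exists>j<m. x j > 0"
    using x_sum x_nonneg by (metis lessThan_iff less_eq_real_def sum.neutral zero_neq_one)
  then obtain j0 where j0: "j0 < m" "x j0 > 0" by blast
  have eig: "mat_act B x i = r * x i" if i: "i < m" for i
  proof (rule ccontr)
    assume "mat_act B x i \<noteq> r * x i"
    then have strict: "mat_act B x i - r * x i > 0" using sub[OF i] by simp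
    define y where "y = mat_act (B ^\<^sub>m k) x"
    have y_pos: "y l > 0" if "l < m" for l
      unfolding y_def using act_pos[of x j0 l] x_nonneg j0 that by simp
    have gap: "mat_act B y l - r * y l > 0" if l: "l < m" for l
    proof -
      have "mat_act B y l = mat_act (B * B ^\<^sub>m k) x l"
        unfolding y_def by (rule mat_act_mult[OF B pw l, symmetric])
      also have "\<dots> = mat_act (B ^\<^sub>m k * B) x l" using pow_mat_Suc_left[OF B, of k] by simp
      also have "\<dots> = mat_act (B ^\<^sub>m k) (mat_act B x) l" by (rule mat_act_mult[OF pw B l])
      finally have "mat_act B y l - r * y l = mat_act (B ^\<^sub>m k) (\<lambda>j. mat_act B x j - r * x j) l"
        by (simp add: mat_act_diff y_def)
      also have "\<dots> > 0" using sub strict i l by (intro act_pos[of _ i]) auto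
      finally show ?thesis .
    qed
    define \<epsilon> where "\<epsilon> = Min ((\<lambda>l. (mat_act B y l - r * y l) / y l) ` {..<m})"
    have \<epsilon>_le: "\<epsilon> \<le> (mat_act B y l - r * y l) / y l" if "l < m" for l
      unfolding \<epsilon>_def using that by (intro Min_le) auto
    have "\<epsilon> > 0" unfolding \<epsilon>_def using m gap y_pos by (subst Min_gr_iff) auto
    define Y where "Y = (\<Sum>l<m. y l)"
    have Y: "Y > 0" unfolding Y_def using y_pos m by (intro sum_pos) auto
    define z where "z l = (if l < m then y l / Y else 0)" for l
    have z_act: "mat_act B z l = mat_act B y l / Y" for l
      using B by (simp add: mat_act_def z_def sum_divide_distrib)
    have z_nonneg: "z l \<ge> 0" for l using y_pos[of l] Y by (auto simp: z_def less_imp_le)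
    have z_sum: "(\<Sum>l<m. z l) = 1" using Y by (simp add: z_def Y_def flip: sum_divide_distrib)
    have z_sub: "(r + \<epsilon>) * z l \<le> mat_act B z l" if "l < m" for l
    proof -
      have "(r + \<epsilon>) * y l \<le> mat_act B y l"
        using \<epsilon>_le[OF that] y_pos[OF that] by (simp add: field_simps)
      then show ?thesis using Y that by (simp add: z_act z_def divide_right_mono)
    qed
    have "r + \<epsilon> = (\<Sum>l<m. (r + \<epsilon>) * z l)" by (simp add: z_sum flip: sum_distrib_left)
    also have "\<dots> \<le> (\<Sum>l<m. mat_act B z l)" using z_sub by (intro sum_mono) auto
    also have "\<dots> \<le> R"
    proof -
      have "z j \<le> 1" if "j < m" for j
        using member_le_sum[of j "{..<m}" z] z_nonneg z_sum that by auto
      then show ?thesis unfolding R_def mat_act_def using B nonneg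
        by (auto intro!: sum_mono mult_left_le)
    qed
    finally have "(r + \<epsilon>, z) \<in> K"
      using x \<open>\<epsilon> > 0\<close> z_nonneg z_sum z_sub by (auto simp: K_def z_def)
    then have "r + \<epsilon> \<in> fst ` K" by (intro image_eqI[of _ _ "(r + \<epsilon>, z)"]) simp_all
    then have "r + \<epsilon> \<le> r" using r(2) by blast
    then show False using \<open>\<epsilon> > 0\<close> by simp
  qed
  have "\<forall>i<m. mat_act B x i = r * x i" using eig by blast
  note pow_eig = mat_act_pow_eigenvector[OF B this]
  have all_pos: "r ^ k * x i > 0" if "i < m" for i
    using act_pos[of x j0 i] x_nonneg j0 that pow_eig by simp
  have "r \<noteq> 0" using all_pos[OF m] k by (auto simp: zero_power)
  then have "r > 0" using x by (simp add: K_def)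
  moreover have "x i > 0" if "i < m" for i using all_pos[OF that] \<open>r > 0\<close> by (simp add: zero_less_mult_iff)
  ultimately show ?thesis using eig by blast
qed

text \<open>Doeblin's contraction argument. Averaging cannot widen the interval between the smallest and the
  largest value. If after \<open>k\<close> steps every weight is at least \<open>\<delta>\<close>, the largest value enters
  each new average with weight \<open>\<delta>\<close> at least, so the minimum rises by a fixed fraction of the
  width of the interval, and in the limit this width is zero.\<close>

lemma averaging_limit:
  fixes q :: "nat \<Rightarrow> nat \<Rightarrow> real"
  assumes m: "m > 0"
    and W: "\<And>t i. i < m \<Longrightarrow> q (Suc t) i = (\<Sum>l<m. W i l * q t l)"
      "\<And>i l. i < m \<Longrightarrow> l < m \<Longrightarrow> W i l \<ge> 0" "\<And>i. i < m \<Longrightarrow> (\<Sum>l<m. W i l) = 1"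
    and V: "\<And>t i. i < m \<Longrightarrow> q (t + k) i = (\<Sum>l<m. V i l * q t l)"
      "\<And>i l. i < m \<Longrightarrow> l < m \<Longrightarrow> V i l > 0" "\<And>i. i < m \<Longrightarrow> (\<Sum>l<m. V i l) = 1"
  shows "\<exists>L. (\<forall>i<m. (\<lambda>t. q t i) \<longlonglongrightarrow> L) \<and> (\<forall>t. Min (q t ` {..<m}) \<le> L)"
proof -
  define lo where "lo t = Min (q t ` {..<m})" for t
  define hi where "hi t = Max (q t ` {..<m})" for t
  have lo_le: "lo t \<le> q t i" and le_hi: "q t i \<le> hi t" if "i < m" for t i
    using that by (auto simp: lo_def hi_def)
  have ne: "{..<m} \<noteq> {}" using m by auto
  have lo_ge: "c \<le> lo t" if "\<And>i. i < m \<Longrightarrow> c \<le> q t i" for c t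
    unfolding lo_def using that ne by (subst Min_ge_iff) auto
  have hi_le: "hi t \<le> c" if "\<And>i. i < m \<Longrightarrow> q t i \<le> c" for c t
    unfolding hi_def using that ne by (subst Max_le_iff) auto
  have lo_hi: "lo t \<le> hi t" for t using lo_le[OF m] le_hi[OF m] by (rule order.trans)
  have "incseq lo"
  proof (intro incseq_SucI lo_ge)
    fix t i assume i: "i < m"
    have "lo t = (\<Sum>l<m. W i l * lo t)" using W(3)[OF i] by (simp flip: sum_distrib_right)
    also have "\<dots> \<le> q (Suc t) i"
      unfolding W(1)[OF i] using W(2)[OF i] lo_le by (intro sum_mono mult_left_mono) auto
    finally show "lo t \<le> q (Suc t) i" .
  qed
  have "decseq hi"
  proof (intro decseq_SucI hi_le)
    fix t i assume i: "i < m"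
    have "q (Suc t) i \<le> (\<Sum>l<m. W i l * hi t)"
      unfolding W(1)[OF i] using W(2)[OF i] le_hi by (intro sum_mono mult_left_mono) auto
    also have "\<dots> = hi t" using W(3)[OF i] by (simp flip: sum_distrib_right)
    finally show "q (Suc t) i \<le> hi t" .
  qed
  have lo_hi': "lo s \<le> hi t" for s t
  proof -
    have "lo s \<le> lo (max s t)" using \<open>incseq lo\<close> by (rule incseqD) simp
    also have "\<dots> \<le> hi (max s t)" by (rule lo_hi)
    also have "\<dots> \<le> hi t" using \<open>decseq hi\<close> by (rule decseqD) simp
    finally show ?thesis .
  qed
  obtain a where a: "lo \<longlonglongrightarrow> a" "\<And>t. lo t \<le> a"
    using incseq_convergent[OF \<open>incseq lo\<close>, of "hi 0"] lo_hi' by auto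
  have "\<forall>t. lo 0 \<le> hi t" using lo_hi' by blast
  then obtain b where b: "hi \<longlonglongrightarrow> b" "\<forall>t. b \<le> hi t"
    by (rule decseq_convergent[OF \<open>decseq hi\<close>])
  define \<delta> where "\<delta> = Min ((\<lambda>(i, l). V i l) ` ({..<m} \<times> {..<m}))"
  have \<delta>_le: "\<delta> \<le> V i l" if "i < m" "l < m" for i l
    unfolding \<delta>_def using that by (intro Min_le) auto
  have "\<delta> > 0" unfolding \<delta>_def using ne V(2) by (subst Min_gr_iff) auto
  have "lo t + \<delta> * (hi t - lo t) \<le> lo (t + k)" for t
  proof (intro lo_ge)
    fix i assume i: "i < m"
    have "hi t \<in> q t ` {..<m}" unfolding hi_def using ne by (intro Max_in) auto
    then obtain l where l: "l < m" "q t l = hi t" by auto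
    have "\<delta> * (hi t - lo t) \<le> V i l * (q t l - lo t)"
      using \<delta>_le[OF i l(1)] l lo_hi by (simp add: mult_right_mono)
    also have "\<dots> \<le> (\<Sum>l<m. V i l * (q t l - lo t))"
      using l lo_le less_imp_le[OF V(2)[OF i]]
      by (intro member_le_sum) (auto intro!: mult_nonneg_nonneg)
    also have "\<dots> = q (t + k) i - lo t"
      unfolding V(1)[OF i] using V(3)[OF i] by (simp add: right_diff_distrib sum_subtractf flip: sum_distrib_right)
    finally show "lo t + \<delta> * (hi t - lo t) \<le> q (t + k) i" by simp
  qed
  moreover have "(\<lambda>t. lo t + \<delta> * (hi t - lo t)) \<longlonglongrightarrow> a + \<delta> * (b - a)"
    by (intro tendsto_intros a b)
  moreover have "(\<lambda>t. lo (t + k)) \<longlonglongrightarrow> a" by (rule LIMSEQ_ignore_initial_segment[OF a(1)])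
  ultimately have "a + \<delta> * (b - a) \<le> a" by (meson LIMSEQ_le)
  then have "b \<le> a" using \<open>\<delta> > 0\<close> by (simp add: mult_le_0_iff)
  moreover have "a \<le> b" using a(1) b lo_hi by (meson LIMSEQ_le)
  ultimately have hi_lim: "hi \<longlonglongrightarrow> a" using b by simp
  have "(\<lambda>t. q t i) \<longlonglongrightarrow> a" if "i < m" for i
    by (rule tendsto_sandwich[OF _ _ a(1) hi_lim]) (use that lo_le le_hi in simp_all)
  then show ?thesis using a(2) unfolding lo_def by blast
qed

text \<open>Conjugating \<open>B / r\<close> by the diagonal matrix of the Perron eigenvector \<open>x\<close> turns it into a
  row-stochastic matrix, so each column of its powers evolves by averaging and its entries converge to
  a common limit. At time \<open>k\<close> all these entries are positive, and their minimum is a lower bound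
  of the limit.\<close>

theorem primitive_power_asymptotics:
  assumes B: "B \<in> carrier_mat m m" and nonneg: "\<forall>i<m. \<forall>j<m. (0::real) \<le> B $$ (i, j)"
    and prim: "primitive_mat B"
  shows "\<exists>r>0. \<forall>i<m. \<forall>j<m. \<exists>c>0. (\<lambda>t. (B ^\<^sub>m t) $$ (i, j) / r ^ t) \<longlonglongrightarrow> c"
proof (cases "m = 0")
  case True
  then show ?thesis by (intro exI[of _ 1]) auto
next
  case False
  then have m: "m > 0" by simp
  obtain k where k: "k > 0" and pos: "\<forall>i<m. \<forall>j<m. (B ^\<^sub>m k) $$ (i, j) > 0"
    using prim B by (auto simp: primitive_mat_def)
  obtain r x where r: "r > 0" and x: "\<And>i. i < m \<Longrightarrow> x i > 0" and eig: "\<And>i. i < m \<Longrightarrow> mat_act B x i = r * x i"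
    using Perron_eigenvector[OF B nonneg k pos m] by blast
  note pw = pow_carrier_mat[OF B]
  have "\<forall>i<m. mat_act B x i = r * x i" using eig by blast
  note eig_pow = mat_act_pow_eigenvector[OF B this]
  have pow_add: "B ^\<^sub>m (s + t) = B ^\<^sub>m s * B ^\<^sub>m t" for s t
  proof (induction t)
    case (Suc t)
    then show ?case using assoc_mult_mat[OF pw pw B, of s t] by simp
  qed (use pw[of s] B in simp)
  have "\<exists>c>0. (\<lambda>t. (B ^\<^sub>m t) $$ (i, j) / r ^ t) \<longlonglongrightarrow> c" if i: "i < m" and j: "j < m" for i j
  proof -
    define q where "q t i = (B ^\<^sub>m t) $$ (i, j) / (r ^ t * x i)" for t i
    define W where "W s i l = (B ^\<^sub>m s) $$ (i, l) * x l / (r ^ s * x i)" for s i l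
    have step: "q (t + s) i = (\<Sum>l<m. W s i l * q t l)" if i: "i < m" for t s i
    proof -
      have "(B ^\<^sub>m (t + s)) $$ (i, j) = (\<Sum>l<m. (B ^\<^sub>m s) $$ (i, l) * (B ^\<^sub>m t) $$ (l, j))"
        by (subst add.commute) (simp only: pow_add mat_mult_index[OF pw pw i j])
      moreover have "W s i l * q t l = (B ^\<^sub>m s) $$ (i, l) * (B ^\<^sub>m t) $$ (l, j) / (r ^ (t + s) * x i)" if "l < m" for l
        using r x[OF that] by (simp add: W_def q_def power_add)
      ultimately show ?thesis by (simp add: q_def sum_divide_distrib)
    qed
    have sum1: "(\<Sum>l<m. W s i l) = 1" if i: "i < m" for s i
      using eig_pow[OF i, of s] r x[OF i] carrier_matD(2)[OF pw[of s]]
      by (simp add: W_def mat_act_def del: pow_mat_dim flip: sum_divide_distrib)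
    have "\<exists>L. (\<forall>i<m. (\<lambda>t. q t i) \<longlonglongrightarrow> L) \<and> (\<forall>t. Min (q t ` {..<m}) \<le> L)"
    proof (rule averaging_limit[OF m, where W = "W 1" and V = "W k" and k = k])
      show "q (Suc t) i = (\<Sum>l<m. W 1 i l * q t l)" if "i < m" for t i using step[OF that, of t 1] by simp
      show "W 1 i l \<ge> 0" if "i < m" "l < m" for i l
        unfolding W_def using pow_mat_nonneg[OF B nonneg that, of 1] x[OF that(1)] x[OF that(2)] r
        by (intro divide_nonneg_nonneg mult_nonneg_nonneg) auto
      show "W k i l > 0" if "i < m" "l < m" for i l
        unfolding W_def using pos x[OF that(1)] x[OF that(2)] r that
        by (intro divide_pos_pos mult_pos_pos zero_less_power) auto
      show "q (t + k) i = (\<Sum>l<m. W k i l * q t l)" if "i < m" for t i by (rule step[OF that])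
      show "(\<Sum>l<m. W 1 i l) = 1" "(\<Sum>l<m. W k i l) = 1" if "i < m" for i by (rule sum1[OF that])+
    qed
    then obtain L where L: "\<And>i. i < m \<Longrightarrow> (\<lambda>t. q t i) \<longlonglongrightarrow> L" "\<And>t. Min (q t ` {..<m}) \<le> L"
      by blast
    have "Min (q k ` {..<m}) > 0" using m pos x r j
      by (subst Min_gr_iff) (auto simp: q_def intro!: divide_pos_pos mult_pos_pos zero_less_power)
    then have "L > 0" using L(2)[of k] by linarith
    have "(\<lambda>t. x i * q t i) \<longlonglongrightarrow> x i * L" by (intro tendsto_intros L i)
    moreover have "x i * q t i = (B ^\<^sub>m t) $$ (i, j) / r ^ t" for t using x[OF i] by (simp add: q_def)
    ultimately show ?thesis using \<open>L > 0\<close> x[OF i] by (intro exI[of _ "x i * L"]) auto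
  qed
  then show ?thesis using r by blast
qed

section \<open>The block structure\<close>

lemma pow_mat_of_int:
  assumes "B \<in> carrier_mat m m"
  shows "map_mat real_of_int B ^\<^sub>m k = map_mat real_of_int (B ^\<^sub>m k)"
  by (rule of_int_hom.mat_hom_pow[OF assms, symmetric])

lemma primitive_mat_of_int:
  assumes "primitive_mat B"
  shows "primitive_mat (map_mat real_of_int B)"
proof -
  obtain k where sq: "square_mat B" and k: "k > 0"
    and pos: "\<forall>i<dim_row B. \<forall>j<dim_row B. (B ^\<^sub>m k) $$ (i, j) > 0"
    using assms unfolding primitive_mat_def by blast
  have B: "B \<in> carrier_mat (dim_row B) (dim_row B)"
    by (rule carrier_matI) (use sq in simp_all)
  have "(map_mat real_of_int B ^\<^sub>m k) $$ (i, j) > 0" if "i < dim_row B" "j < dim_row B" for i j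
    using pos that carrier_matD[OF pow_carrier_mat[OF B, of k]]
    by (simp add: pow_mat_of_int[OF B] del: pow_mat_dim)
  then show ?thesis
    using sq k unfolding primitive_mat_def by (intro conjI exI[of _ k]) simp_all
qed

lemma submatrix_map_mat:
  "submatrix (map_mat f A) I J = map_mat f (submatrix A I J)"
proof (rule eq_matI)
  fix i j assume "i < dim_row (map_mat f (submatrix A I J))" "j < dim_col (map_mat f (submatrix A I J))"
  then have ij: "i < card {i. i < dim_row A \<and> i \<in> I}" "j < card {j. j < dim_col A \<and> j \<in> J}"
    by (simp_all add: dim_submatrix)
  then show "submatrix (map_mat f A) I J $$ (i, j) = map_mat f (submatrix A I J) $$ (i, j)"
    using pick_le[OF ij(1)] pick_le[OF ij(2)] by (simp add: submatrix_index dim_submatrix)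
qed (simp_all add: dim_submatrix)

lemma block_indices_eq:
  "p < length ns \<Longrightarrow> block_indices ns p = {sum_list (take p ns) ..< sum_list (take p ns) + ns ! p}"
  by (simp add: block_indices_def take_Suc_conv_app_nth)

lemma sum_list_take_le: "sum_list (take p ns) \<le> sum_list (ns :: nat list)"
  by (metis append_take_drop_id le_add1 sum_list_append)

lemma mat_block_carrier_index:
  assumes "A \<in> carrier_mat n n" "sum_list ns = n" "p < length ns" "q < length ns"
  shows "mat_block ns A p q \<in> carrier_mat (ns ! p) (ns ! q)"
    and "i < ns ! p \<Longrightarrow> j < ns ! q \<Longrightarrow>
      mat_block ns A p q $$ (i, j) = A $$ (sum_list (take p ns) + i, sum_list (take q ns) + j)"
proof -
  have bd: "sum_list (take p ns) + ns ! p \<le> n" if "p < length ns" for p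
    using sum_list_take_le[of "Suc p" ns] that assms(2) by (simp add: take_Suc_conv_app_nth)
  have set_eq: "{i. i < n \<and> i \<in> block_indices ns p} = {sum_list (take p ns) ..< sum_list (take p ns) + ns ! p}"
    if "p < length ns" for p
    using bd[OF that] that by (auto simp: block_indices_eq)
  show "mat_block ns A p q \<in> carrier_mat (ns ! p) (ns ! q)"
    by (intro carrier_matI)
      (simp_all add: mat_block_def dim_submatrix carrier_matD[OF assms(1)] set_eq assms(3,4))
  assume ij: "i < ns ! p" "j < ns ! q"
  have pick: "card {a \<in> block_indices ns p. a < sum_list (take p ns) + i} = i"
    if "i < ns ! p" "p < length ns" for p i
  proof -
    have "{a \<in> block_indices ns p. a < sum_list (take p ns) + i} = {sum_list (take p ns) ..< sum_list (take p ns) + i}"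
      using that by (auto simp: block_indices_eq)
    then show ?thesis by simp
  qed
  have "submatrix A (block_indices ns p) (block_indices ns q) $$
      (card {a \<in> block_indices ns p. a < sum_list (take p ns) + i}, card {a \<in> block_indices ns q. a < sum_list (take q ns) + j})
    = A $$ (sum_list (take p ns) + i, sum_list (take q ns) + j)"
    using assms ij bd[of p] bd[of q] by (intro submatrix_index_card) (auto simp: block_indices_eq)
  then show "mat_block ns A p q $$ (i, j) = A $$ (sum_list (take p ns) + i, sum_list (take q ns) + j)"
    using pick[OF ij(1) assms(3)] pick[OF ij(2) assms(4)] by (simp add: mat_block_def)
qed

lemma block_of_index:
  fixes ns :: "nat list"
  assumes "j < sum_list ns" "sum_list (take p ns) \<le> j" "p \<le> length ns"
  shows "\<exists>q l. p \<le> q \<and> q < length ns \<and> l < ns ! q \<and> j = sum_list (take q ns) + l"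
  using assms(3,2)
proof (induction p rule: inc_induct)
  case base
  then have False using assms(1) by simp
  then show ?case ..
next
  case (step p)
  show ?case
  proof (cases "sum_list (take (Suc p) ns) \<le> j")
    case True
    then show ?thesis using step.IH Suc_leD by blast
  next
    case False
    then show ?thesis using step
      by (intro exI[of _ p] exI[of _ "j - sum_list (take p ns)"]) (auto simp: take_Suc_conv_app_nth)
  qed
qed

section \<open>Growth in a block triangular system\<close>

text \<open>The discrete Duhamel formula. The initial value is treated as input at time zero, and the input
  \<open>b t\<close> takes effect at time \<open>t + 1\<close>; with this convention the solution is a plain
  convolution.\<close>

lemma variation_of_constants:
  assumes B: "B \<in> carrier_mat m m"
    and rec: "\<And>t i. i < m \<Longrightarrow> u (Suc t) i = mat_act B (u t) i + b t i"
  defines "g \<equiv> \<lambda>j t. case t of 0 \<Rightarrow> u 0 j | Suc s \<Rightarrow> b s j"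
  assumes "i < m"
  shows "u t i = (\<Sum>j<m. \<Sum>s\<le>t. (B ^\<^sub>m s) $$ (i, j) * g j (t - s))"
proof -
  note pw = pow_carrier_mat[OF B]
  have act_one: "mat_act (B ^\<^sub>m 0) x i = x i" if "i < m" for x i
  proof -
    have "mat_act (B ^\<^sub>m 0) x i = (\<Sum>j<m. if j = i then x j else 0)"
      unfolding mat_act_def using B that by (intro sum.cong) auto
    then show ?thesis using that by simp
  qed
  have "u t i = (\<Sum>s\<le>t. mat_act (B ^\<^sub>m s) (\<lambda>j. g j (t - s)) i)"
    using \<open>i < m\<close>
  proof (induction t arbitrary: i)
    case 0
    then show ?case using act_one[of i "\<lambda>j. g j 0"] by (simp add: g_def)
  next
    case (Suc t)
    have "(\<Sum>s\<le>Suc t. mat_act (B ^\<^sub>m s) (\<lambda>j. g j (Suc t - s)) i) =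
        mat_act (B ^\<^sub>m 0) (\<lambda>j. g j (Suc t)) i + (\<Sum>s\<le>t. mat_act (B ^\<^sub>m Suc s) (\<lambda>j. g j (t - s)) i)"
      by (subst sum.atMost_Suc_shift) (simp only: diff_Suc_Suc diff_zero)
    also have "(\<Sum>s\<le>t. mat_act (B ^\<^sub>m Suc s) (\<lambda>j. g j (t - s)) i) =
        (\<Sum>s\<le>t. mat_act B (mat_act (B ^\<^sub>m s) (\<lambda>j. g j (t - s))) i)"
      by (simp only: pow_mat_Suc_left[OF B] mat_act_mult[OF B pw Suc.prems])
    also have "\<dots> = mat_act B (\<lambda>l. \<Sum>s\<le>t. mat_act (B ^\<^sub>m s) (\<lambda>j. g j (t - s)) l) i"
      unfolding mat_act_def[of B] sum_distrib_left by (rule sum.swap)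
    also have "\<dots> = mat_act B (u t) i"
      using B Suc.IH by (intro mat_act_cong) simp
    finally show ?case
      using rec[OF Suc.prems, of t] act_one[OF Suc.prems] by (simp add: g_def)
  qed
  also have "\<dots> = (\<Sum>s\<le>t. \<Sum>j<m. (B ^\<^sub>m s) $$ (i, j) * g j (t - s))"
    by (simp only: mat_act_def carrier_matD(2)[OF pw])
  also have "\<dots> = (\<Sum>j<m. \<Sum>s\<le>t. (B ^\<^sub>m s) $$ (i, j) * g j (t - s))" by (rule sum.swap)
  finally show ?thesis .
qed

text \<open>A block of size one with entry \<open>1\<close> is itself primitive. For the entry \<open>0\<close> the block has
  no memory and merely passes on its input.\<close>

lemma block_regular_growth:
  assumes B: "B \<in> carrier_mat m m" and nonneg: "\<forall>i<m. \<forall>j<m. (0::real) \<le> B $$ (i, j)"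
    and kind: "primitive_mat B \<or> m = 1 \<and> B $$ (0, 0) \<in> {0, 1}"
    and rec: "\<And>t i. i < m \<Longrightarrow> u (Suc t) i = mat_act B (u t) i + b t i"
    and u_nonneg: "\<And>i. i < m \<Longrightarrow> u 0 i \<ge> 0" and b_nonneg: "\<And>t i. i < m \<Longrightarrow> b t i \<ge> 0"
    and b_growth: "\<And>i. i < m \<Longrightarrow> regular_growth (\<lambda>t. b t i)"
    and i: "i < m"
  shows "regular_growth (\<lambda>t. u t i)"
proof (cases "primitive_mat B \<or> B $$ (0, 0) = 1")
  case True
  have "primitive_mat B"
  proof (cases "primitive_mat B")
    case False
    then have "m = 1" "B $$ (0, 0) = 1" using kind True by auto
    then show ?thesis using B by (auto simp: primitive_mat_def scalar_prod_def intro!: exI[of _ 1])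
  qed
  then obtain r where r: "r > 0"
    and lim: "\<forall>i<m. \<forall>j<m. \<exists>c>0. (\<lambda>t. (B ^\<^sub>m t) $$ (i, j) / r ^ t) \<longlonglongrightarrow> c"
    using primitive_power_asymptotics[OF B nonneg] by blast
  define g where "g j t = (case t of 0 \<Rightarrow> u 0 j | Suc s \<Rightarrow> b s j)" for j t
  have "u t i = (\<Sum>j<m. \<Sum>s\<le>t. (B ^\<^sub>m s) $$ (i, j) * g j (t - s))" for t
    unfolding g_def by (rule variation_of_constants[where u = u and b = b, OF B rec i])
  moreover have "regular_growth (\<lambda>t. \<Sum>s\<le>t. (B ^\<^sub>m s) $$ (i, j) * g j (t - s))" if j: "j < m" for j
  proof -
    obtain c where "c > 0" "(\<lambda>t. (B ^\<^sub>m t) $$ (i, j) / r ^ t) \<longlonglongrightarrow> c" using lim i j by blast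
    moreover have "regular_growth (g j)"
      by (rule regular_growth_of_Suc) (use b_growth[OF j] in \<open>simp add: g_def\<close>)
    moreover have "g j t \<ge> 0" for t
      using u_nonneg[OF j] b_nonneg[OF j] by (simp add: g_def split: nat.split)
    ultimately show ?thesis
      by (intro regular_growth_convolution[OF r, where c = c] pow_mat_nonneg[OF B nonneg i j]) auto
  qed
  ultimately show ?thesis
    using regular_growth_sum[of "{..<m}" "\<lambda>j t. \<Sum>s\<le>t. (B ^\<^sub>m s) $$ (i, j) * g j (t - s)"] by simp
next
  case False
  then have "m = 1" "B $$ (0, 0) = 0" using kind by auto
  then have "u (Suc t) i = b t i" for t using rec[OF i, of t] B i by (simp add: mat_act_def)
  then have "regular_growth (\<lambda>t. u (Suc t) i)" using b_growth[OF i] by simp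
  then show ?thesis by (rule regular_growth_of_Suc)
qed

text \<open>The rows of a block involve only the block itself and the blocks before it, so the blocks can be
  treated one after the other, the earlier ones supplying the input of the next.\<close>

theorem Frobenius_regular_growth:
  fixes A :: "real mat" and u :: "nat \<Rightarrow> nat \<Rightarrow> real"
  assumes A: "A \<in> carrier_mat n n" and nonneg: "\<forall>i<n. \<forall>j<n. 0 \<le> A $$ (i, j)"
    and form: "primitive_Frobenius_form A"
    and u_nonneg: "\<And>t i. i < n \<Longrightarrow> u t i \<ge> 0"
    and rec: "\<And>t i. i < n \<Longrightarrow> u (Suc t) i = mat_act A (u t) i"
    and i: "i < n"
  shows "regular_growth (\<lambda>t. u t i)"
proof -
  obtain ns where n: "sum_list ns = n"
    and zero: "\<And>p q. p < q \<Longrightarrow> q < length ns \<Longrightarrow> mat_block ns A p q = 0\<^sub>m (ns ! p) (ns ! q)"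
    and diag: "\<And>p. p < length ns \<Longrightarrow> primitive_mat (mat_block ns A p p) \<or>
           ns ! p = 1 \<and> mat_block ns A p p $$ (0, 0) \<in> {0, 1}"
    using form A unfolding primitive_Frobenius_form_def by auto
  define start where "start p = sum_list (take p ns)" for p
  have start_Suc: "start (Suc p) = start p + ns ! p" if "p < length ns" for p
    using that by (simp add: start_def take_Suc_conv_app_nth)
  have start_le: "start p \<le> n" for p using sum_list_take_le[of p ns] n by (simp add: start_def)
  have block: "mat_block ns A p q \<in> carrier_mat (ns ! p) (ns ! q)"
    "i < ns ! p \<Longrightarrow> j < ns ! q \<Longrightarrow> mat_block ns A p q $$ (i, j) = A $$ (start p + i, start q + j)"
    if "p < length ns" "q < length ns" for p q i j
    using mat_block_carrier_index[OF A n that] by (simp_all add: start_def)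
  have upper_zero: "A $$ (start p + i, j) = 0" if p: "p < length ns" "i < ns ! p" "start (Suc p) \<le> j" "j < n" for p i j
  proof -
    obtain q l where q: "Suc p \<le> q" "q < length ns" "l < ns ! q" "j = start q + l"
      using block_of_index[of j ns "Suc p"] p n by (auto simp: start_def)
    then show ?thesis
      using block(2)[OF p(1) q(2) p(2) q(3)] zero[of p q] p by simp
  qed
  have "p \<le> length ns \<Longrightarrow> (\<forall>i<start p. regular_growth (\<lambda>t. u t i))" for p
  proof (induction p)
    case 0
    then show ?case by (simp add: start_def)
  next
    case (Suc p)
    then have p: "p < length ns" and IH: "\<And>i. i < start p \<Longrightarrow> regular_growth (\<lambda>t. u t i)" by auto
    let ?m = "ns ! p" and ?s = "start p"
    have le: "?s + ?m \<le> n" using start_le[of "Suc p"] start_Suc[OF p] by simp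
    let ?B = "mat_block ns A p p"
    define b where "b t i = (\<Sum>j<?s. A $$ (?s + i, j) * u t j)" for t i
    have "regular_growth (\<lambda>t. u t (?s + i))" if "i < ?m" for i
    proof (rule block_regular_growth[of ?B ?m "\<lambda>t i. u t (?s + i)" b, OF block(1)[OF p p] _ diag[OF p]])
      show "\<forall>i<?m. \<forall>j<?m. 0 \<le> ?B $$ (i, j)" using block(2)[OF p p] nonneg le by simp
      show "u (Suc t) (?s + i) = mat_act ?B (\<lambda>i. u t (?s + i)) i + b t i" if i: "i < ?m" for t i
      proof -
        have "u (Suc t) (?s + i) = (\<Sum>j<n. A $$ (?s + i, j) * u t j)"
          using rec[of "?s + i" t] i le A by (simp add: mat_act_def)
        also have "\<dots> = (\<Sum>j<?s + ?m. A $$ (?s + i, j) * u t j)"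
          using upper_zero[OF p i] start_Suc[OF p] le by (intro sum.mono_neutral_right) auto
        also have "\<dots> = b t i + (\<Sum>j\<in>{?s..<?s + ?m}. A $$ (?s + i, j) * u t j)"
          unfolding b_def by (subst sum.union_disjoint[symmetric]) (auto intro: sum.cong)
        also have "(\<Sum>j\<in>{?s..<?s + ?m}. A $$ (?s + i, j) * u t j) = (\<Sum>j<?m. A $$ (?s + i, ?s + j) * u t (?s + j))"
          by (rule sum.reindex_bij_witness[of _ "\<lambda>j. ?s + j" "\<lambda>j. j - ?s"]) auto
        also have "\<dots> = mat_act ?B (\<lambda>i. u t (?s + i)) i"
          using block(2)[OF p p i] carrier_matD(2)[OF block(1)[OF p p]] by (simp add: mat_act_def)
        finally show ?thesis by simp
      qed
      show "0 \<le> b t i" if "i < ?m" for t i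
        unfolding b_def using nonneg u_nonneg le that by (intro sum_nonneg mult_nonneg_nonneg) auto
      show "regular_growth (\<lambda>t. b t i)" if "i < ?m" for i
        unfolding b_def using nonneg le that IH by (intro regular_growth_sum regular_growth_cmult) auto
    qed (use u_nonneg le that in auto)
    then have "regular_growth (\<lambda>t. u t i)" if "?s \<le> i" "i < ?s + ?m" for i
      using that by (metis add_diff_inverse_nat nat_add_left_cancel_less not_le)
    then show ?case using IH start_Suc[OF p] not_le by metis
  qed
  from this[of "length ns"] show ?thesis using i n by (simp add: start_def)
qed

lemma primitive_Frobenius_form_of_int:
  assumes "primitive_Frobenius_form M"
  shows "primitive_Frobenius_form (map_mat real_of_int M)"
proof -
  have blk: "mat_block ns (map_mat real_of_int M) p q = map_mat real_of_int (mat_block ns M p q)" for ns p q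
    by (simp add: mat_block_def submatrix_map_mat)
  obtain ns where sq: "square_mat M" and ns: "\<forall>s\<in>set ns. s > 0" "sum_list ns = dim_row M"
    and zero: "\<And>p q. p < q \<Longrightarrow> q < length ns \<Longrightarrow> mat_block ns M p q = 0\<^sub>m (ns ! p) (ns ! q)"
    and diag: "\<And>p. p < length ns \<Longrightarrow> primitive_mat (mat_block ns M p p) \<or>
           ns ! p = 1 \<and> mat_block ns M p p $$ (0, 0) \<in> {0, 1}"
    using assms unfolding primitive_Frobenius_form_def by auto
  have M: "M \<in> carrier_mat (dim_row M) (dim_row M)" using sq by auto
  have "primitive_mat (mat_block ns (map_mat real_of_int M) p p) \<or>
      ns ! p = 1 \<and> mat_block ns (map_mat real_of_int M) p p $$ (0, 0) \<in> {0, 1}" if p: "p < length ns" for p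
    using diag[OF p] primitive_mat_of_int[of "mat_block ns M p p"] mat_block_carrier_index(1)[OF M ns(2) p p]
    by (auto simp: blk)
  moreover have "mat_block ns (map_mat real_of_int M) p q = 0\<^sub>m (ns ! p) (ns ! q)"
    if "p < q" "q < length ns" for p q
    unfolding blk zero[OF that] by (intro eq_matI) auto
  ultimately show ?thesis
    using sq ns unfolding primitive_Frobenius_form_def by (intro conjI exI[of _ ns]) auto
qed

section \<open>Normalized iterates converge to an eigenvector\<close>

theorem theorem5p1:
  fixes n :: nat and M :: "int mat" and v :: "real vec"
  assumes M_carrier: "M \<in> carrier_mat n n"
    and M_nonneg: "\<forall>i<n. \<forall>j<n. 0 \<le> M $$ (i, j)"
    and M_form: "primitive_Frobenius_form M"
    and no_zero_column: "\<forall>j<n. col M j \<noteq> 0\<^sub>v n"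
    and v_carrier: "v \<in> carrier_vec n"
    and v_nonneg: "\<forall>i<n. 0 \<le> v $ i"
    and v_nonzero: "v \<noteq> 0\<^sub>v n"
  shows "\<exists>(h :: nat \<Rightarrow> real) v_inf.
    normalization_function n (\<lambda>t. (map_mat real_of_int M ^\<^sub>m t) *\<^sub>v v) h \<and>
    vec_tendsto n (\<lambda>t. (1 / h t) \<cdot>\<^sub>v ((map_mat real_of_int M ^\<^sub>m t) *\<^sub>v v)) v_inf \<and>
    v_inf \<noteq> 0\<^sub>v n \<and>
    (\<exists>r. eigenvector (map_mat real_of_int M) v_inf r)"
proof -
  define A where "A = map_mat real_of_int M"
  have A: "A \<in> carrier_mat n n" using M_carrier by (simp add: A_def)
  have A_nonneg: "\<forall>i<n. \<forall>j<n. 0 \<le> A $$ (i, j)" using M_nonneg M_carrier by (simp add: A_def)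
  define u where "u t = (A ^\<^sub>m t) *\<^sub>v v" for t
  have u_carrier: "u t \<in> carrier_vec n" for t
    unfolding u_def using pow_carrier_mat[OF A, of t] v_carrier by (rule mult_mat_vec_carrier)
  have act: "(A *\<^sub>v w) $ i = mat_act A (\<lambda>j. w $ j) i" if "i < n" "w \<in> carrier_vec n" for w i
    using that A by (simp add: mat_act_def scalar_prod_def lessThan_atLeast0)
  have rec: "u (Suc t) $ i = mat_act A (\<lambda>j. u t $ j) i" if "i < n" for t i
  proof -
    have "u (Suc t) = A *\<^sub>v u t"
      unfolding u_def pow_mat_Suc_left[OF A]
      by (rule assoc_mult_mat_vec[OF A pow_carrier_mat[OF A] v_carrier])
    then show ?thesis using act[OF that u_carrier[of t]] by simp
  qed
  have u_nonneg: "u t $ i \<ge> 0" if "i < n" for t i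
    using that
  proof (induction t arbitrary: i)
    case 0
    then show ?case using v_nonneg v_carrier A by (simp add: u_def)
  next
    case (Suc t)
    then show ?case using rec[OF Suc.prems, of t] A_nonneg A
      by (auto simp: mat_act_def intro!: sum_nonneg mult_nonneg_nonneg)
  qed
  have u_pos: "\<exists>i<n. u t $ i > 0" for t
  proof (induction t)
    case 0
    have "\<exists>i<n. v $ i \<noteq> 0" using v_nonzero v_carrier by (metis carrier_vecD eq_vecI index_zero_vec)
    then show ?case using v_nonneg v_carrier A by (auto simp: u_def order_le_less)
  next
    case (Suc t)
    then obtain j where j: "j < n" "u t $ j > 0" by blast
    have "\<exists>i<n. M $$ (i, j) \<noteq> 0"
    proof (rule ccontr)
      assume "\<not> ?thesis"
      then have "col M j = 0\<^sub>v n" using M_carrier j by (intro eq_vecI) auto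
      then show False using no_zero_column j by blast
    qed
    then obtain i where i: "i < n" "M $$ (i, j) \<noteq> 0" by blast
    then have "A $$ (i, j) > 0" using M_nonneg M_carrier j by (auto simp: A_def order_le_less)
    then have "u (Suc t) $ i > 0"
      unfolding rec[OF i(1)] mat_act_def using A A_nonneg u_nonneg i j
      by (intro sum_pos2[of _ j]) auto
    then show ?case using i by blast
  qed
  have "\<forall>i\<in>{..<n}. regular_growth (\<lambda>t. u t $ i)"
    using Frobenius_regular_growth[where u = "\<lambda>t i. u t $ i", OF A A_nonneg _ u_nonneg rec]
      primitive_Frobenius_form_of_int[OF M_form] by (auto simp: A_def)
  from common_scale[OF finite_lessThan this] show ?thesis
  proof (elim disjE exE conjE)
    assume "\<forall>i\<in>{..<n}. \<forall>\<^sub>F t in sequentially. u t $ i = 0"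
    then have "\<forall>\<^sub>F t in sequentially. \<forall>i\<in>{..<n}. u t $ i = 0"
      by (simp add: eventually_ball_finite)
    then obtain t where "\<forall>i<n. u t $ i = 0" by (auto simp: eventually_sequentially)
    then show ?thesis using u_pos[of t] by auto
  next
    fix r k c
    assume r: "r > 0" and c: "\<forall>i\<in>{..<n}. 0 \<le> c i \<and> (\<lambda>t. u t $ i / growth_scale r k t) \<longlonglongrightarrow> c i"
      and c_pos: "\<exists>i\<in>{..<n}. c i > 0"
    have lim: "(\<lambda>t. u t $ i / growth_scale r k t) \<longlonglongrightarrow> c i" if "i < n" for i using c that by auto
    have tendsto: "vec_tendsto n (\<lambda>t. (1 / growth_scale r k t) \<cdot>\<^sub>v u t) (vec n c)"
    proof -
      have "((1 / growth_scale r k t) \<cdot>\<^sub>v u t) $ i = u t $ i / growth_scale r k t" if "i < n" for t i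
        using that carrier_vecD[OF u_carrier[of t]] by simp
      then show ?thesis using u_carrier lim by (auto simp: vec_tendsto_def)
    qed
    have nz: "vec n c \<noteq> 0\<^sub>v n" using c_pos by (metis index_vec index_zero_vec(1) lessThan_iff less_irrefl)
    have "mat_act A c i = r * c i" if i: "i < n" for i
      \<comment> \<open>Both sides are limits of the coordinates of \<open>M\<^sup>t\<^sup>+\<^sup>1 v\<close>, normalized by the scale at time \<open>t\<close>.\<close>
    proof (rule LIMSEQ_unique)
      let ?f = "\<lambda>t. u (Suc t) $ i / growth_scale r k t"
      have "(\<lambda>t. \<Sum>j<n. A $$ (i, j) * (u t $ j / growth_scale r k t)) \<longlonglongrightarrow> mat_act A c i"
      proof -
        have "(\<lambda>t. \<Sum>j<n. A $$ (i, j) * (u t $ j / growth_scale r k t)) \<longlonglongrightarrow> (\<Sum>j<n. A $$ (i, j) * c j)"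
          by (intro tendsto_sum tendsto_mult tendsto_const lim) auto
        then show ?thesis using A by (simp add: mat_act_def)
      qed
      moreover have "(\<Sum>j<n. A $$ (i, j) * (u t $ j / growth_scale r k t)) = ?f t" for t
        using rec[OF i, of t] A by (simp add: mat_act_def sum_divide_distrib)
      ultimately show "?f \<longlonglongrightarrow> mat_act A c i" by simp
      have "(\<lambda>t. growth_scale r k (Suc t) / growth_scale r k t * (u (Suc t) $ i / growth_scale r k (Suc t))) \<longlonglongrightarrow> r * c i"
        by (intro tendsto_mult growth_scale_ratio_tendsto r LIMSEQ_Suc lim i)
      moreover have "growth_scale r k (Suc t) / growth_scale r k t * (u (Suc t) $ i / growth_scale r k (Suc t)) = ?f t" for t
        using growth_scale_pos[OF r, of k "Suc t"] by simp
      ultimately show "?f \<longlonglongrightarrow> r * c i" by (simp only:)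
    qed
    then have "A *\<^sub>v vec n c = r \<cdot>\<^sub>v vec n c"
      using A act[of _ "vec n c"] mat_act_cong[of A "\<lambda>j. vec n c $ j" c] by (intro eq_vecI) auto
    then have "eigenvector A (vec n c) r" using A nz by (simp add: eigenvector_def)
    then show ?thesis
      using tendsto nz unfolding normalization_function_def u_def A_def by blast
  qed
qed

end
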